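(* Let $\{\mathbb F_\vartheta,\vartheta\in\Theta\}$, $\Theta=\Theta_{(r)}\times\Theta_{(c)}$, be a collection of subsets of $\mathfrak F$ whose minimax rates $\varphi_n(\theta):=\phi_n(\mathbb F_\vartheta)$, $\vartheta=(\theta,\bar\theta)$, depend only on $\theta\in\Theta_{(r)}$, and let $\Psi=\{\psi_n(\theta),\theta\in\Theta_{(r)}\}$ be a normalization family, with $\mathfrak p_n=\sup_{\theta\in\Theta_{(r)}}\frac{\psi_n(\theta)}{\varphi_n(\theta)}$. For $\theta\in\Theta_{(r)}$ set $$\Theta^+[\theta]=\Big\{\theta'\in\Theta_{(r)}:\limsup_{n\to\infty}\tfrac{\varphi_n(\theta')}{\varphi_n(\theta)}=0\Big\},\quad \Theta^0[\theta]=\Big\{\theta'\in\Theta_{(r)}:0<\liminf_{n\to\infty}\tfrac{\varphi_n(\theta')}{\varphi_n(\theta)}\le\limsup_{n\to\infty}\tfrac{\varphi_n(\theta')}{\varphi_n(\theta)}<\infty\Big\}.$$ Assume: (A1) for any $\theta\in\Theta_{(r)}$ there are $\mathbb B\in\mathfrak B^\ell$ and $\mathbb T\in\mathfrak T^{\ell-1}(\Theta_{(r)})$ with $\Theta^+[\theta]\supset\mathbb B$ and $\Theta^0[\theta]\subset\mathbb T$; (A2) for any $\theta\in\Theta_{(r)}$ and $\theta'\in\Theta^+[\theta]$ there exists $0<c(\theta,\theta')<1$ such that $\alpha_n(\theta,\theta'):=\frac{\varphi_n(\theta)}{[\varphi_n(\theta')]^{c(\theta,\theta')}}\to\infty$ as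 $n\to\infty$; (A3) for any $\theta\in\Theta_{(r)}$ and $\theta'\in\Theta^+[\theta]$, $\limsup_{n\to\infty}\mathfrak p_n^2[\varphi_n(\theta')]^{1-c(\theta,\theta')}=0$. Assume moreover that for all $\vartheta=(\theta,\bar\theta)$, $\vartheta'=(\theta',\bar\theta')$ in $\Theta$ with $\theta\in\Theta_{(r)}$ and $\theta'\in\Theta^+[\theta]$ there are elements $f_0,M,\Lambda_1,\dots,\Lambda_M,\mathbb Y,\mathbb P$ (possibly depending on $n,\vartheta,\vartheta'$) such that conditions (1)–(5) listed in the context hold with $\mathcal F=\mathbb F_\vartheta$, $\mathbb F=\mathbb F_{\vartheta'}$ and $\psi_n=\psi_n(\theta)$, and such that for $\mathbf i=1$ and $\mathbf i=2$ $$\lim_{n\to\infty}\alpha_n^{-2}(\theta,\theta')\prod_{m=1}^M\int_{\mathbb R^2}e^{\mathbf i\,nS_muv}\,\mathbb P(\mathrm du)\mathbb P(\mathrm dv)=0.$$ If the normalization family $\Psi$ is admissible, then it is the adaptive rate of convergence over $\{\mathbb F_\vartheta,\vartheta\in\Theta\}$, and $\mathfrak p_n$ is the price to pay for adaptation.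
   Context: Abstract density model. $(\mathcal X,\mathfrak B(\mathcal X),\nu)$ is a measure space; one observes $X_1,\dots,X_n$ i.i.d. $\mathcal X$-valued with density $f$ with respect to $\nu$; $\mathbb E_f$ is expectation under the law of $(X_1,\dots,X_n)$. $\Phi$ is a given real functional and $\mathfrak F$ the set of probability densities $f$ with $|\Phi(f)|<\infty$. An estimator is any measurable real function of $(X_1,\dots,X_n)$. $\mathcal R_n[\widetilde\Phi;\mathbb F]=\sup_{f\in\mathbb F}(\mathbb E_f[\widetilde\Phi-\Phi(f)]^2)^{1/2}$; the minimax rate $\phi_n(\mathbb F)$ is the order at which the minimax risk $\inf_{\widetilde\Phi}\mathcal R_n[\widetilde\Phi;\mathbb F]$ tends to zero. It is assumed that a rate-optimal (minimax) estimator exists on each $\mathbb F_\vartheta$. Adaptive rates. For $\ell\ge1$, $\mathfrak B^\ell$ is the set of all subsets of $\mathbb R^\ell$ containing a Euclidean ball; for $\mathbb B\in\mathfrak B^\ell$, $\mathfrak T^{\ell-1}(\mathbb B)$ is the set of all topological manifolds of dimension $\ell-1$ that are subsets of $\mathbb B$. $\Theta_{(r)}\in\mathfrak B^\ell$ for some fixed $\ell$. A family $\mathcal M=\{\mu_n(\theta),\theta\in\Theta_{(r)}\}$ is an admissible normalization family if there is an estimator $\widehat\Phi_{n,\mathcal M}$ with $\limsup_n\mu_n^{-1}(\theta)\mathcal R_n[\widehat\Phi_{n,\mathcal M};\mathbb F_\vartheta]<\infty$ for all $\vartheta=(\theta,\bar\theta)\in\Theta$; $\mathfrak M$ is the set of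 all such families. Put $\Theta_-(\Psi,\mathcal M)=\{\theta\in\Theta_{(r)}:\limsup_n\psi_n(\theta)/\mu_n(\theta)=\infty\}$. $\Psi=\{\psi_n(\theta)\}$ is called the adaptive rate of convergence over $\{\mathbb F_\vartheta,\vartheta\in\Theta\}$ if: (i) $\Psi\in\mathfrak M$; (ii) for every $\mathcal M\in\mathfrak M$ there is $\mathbb T\in\mathfrak T^{\ell-1}(\Theta_{(r)})$ with $\Theta_-(\Psi,\mathcal M)\subset\mathbb T$; (iii) for every $\mathcal M\in\mathfrak M$ and every $\theta\in\Theta_-(\Psi,\mathcal M)$ there is $\Theta[\theta]\subset\Theta_{(r)}$ containing some $\mathbb B\in\mathfrak B^\ell$ such that $\limsup_n\frac{\psi_n(\theta^* )}{\mu_n(\theta^* )}\frac{\psi_n(\theta)}{\mu_n(\theta)}=0$ for all $\theta^*\in\Theta[\theta]$. The price to pay for adaptation is then $\sup_{\theta\in\Theta_{(r)}}\psi_n(\theta)/\phi_n(\mathbb F_\vartheta)$. Parameterized family. $f_0\in\mathfrak F$ is a density, $M\ge1$ an integer, $\Lambda_m:\mathcal X\to\mathbb R$, $m=1,\dots,M$, measurable square-integrable functions, $\mathbb Y\subseteq\mathbb R$ an interval, $\mathbb P$ a probability measure on $\mathbb Y$, $\mathbb P^M$ the product measure on $\mathbb Y^M$. Put $\lambda_m=\int\Lambda_m\,\mathrm d\nu$, $\rho_y=\sum_my_m\lambda_m$, $f_y=(1-\rho_y)f_0+\sum_{m=1}^My_m\Lambda_m$ for $y\in\mathbb Y^M$,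 $e_1=\int u\,\mathbb P(\mathrm du)$, $\Sigma_M=e_1\sum_m\lambda_m$, $\mathfrak S_M=\sup_m|\lambda_m|$, $\mathbb Y_+=\{y\in\mathbb Y^M:\inf_{x}f_y(x)\ge0\}$, $S_m=\int_{\mathcal X}\frac{\Lambda_m^2}{f_0}\,\mathrm d\nu$. All quantities involving $\mathbb P$ are tacitly assumed to exist. Conditions (for given sets $\mathbb F,\mathcal F\subset\mathfrak F$ and sequence $\psi_n$). (1) There are pairwise disjoint $\Pi_1,\dots,\Pi_M\in\mathfrak B(\mathcal X)$ with $\mathrm{supp}(\Lambda_m)=\Pi_m$ for all $m$. (2) $f_0\in\mathbb F$ and $f_0>0$ on $\bigcup_m\Pi_m$. (3) $\mathbb P^M\{y\in\mathbb Y^M:f_y\in\mathcal F\}\ge\frac{230}{231}$. (4) $\psi_n\to0$, $\psi_n\phi_n^{-1}(\mathcal F)\to+\infty$, and for all $n$ large enough $\mathbb P^M\{y\in\mathbb Y^M:|\Phi(f_y)-\Phi(f_0)|>2\psi_n\}\ge\frac{230}{231}$. (5) Either $\lambda_m=0$ for all $m$ and $\mathbb Y_+=\mathbb Y^M$; or $\mathbb Y^M\subseteq[0,1]^M$, $\Lambda_m:\mathcal X\to\mathbb R_+$ for all $m$, and $\Sigma_M\le0.25$, $256\,\mathfrak S_M^2Mn\le1$ for all $n$ large enough.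
   Formalization: Two corrections: the minimax rates φ_n(θ), φ_n(θ') are assumed pairwise comparable (one is o of the other, or same order), and Θ_-(Ψ,M) consists of θ with lim ψ_n(θ)/μ_n(θ)=∞ instead of limsup; with limsup, interleaving families along subsequences violates (iii). *)

theory Defs
  imports "HOL-Probability.Probability" "HOL-Library.Landau_Symbols"
begin

section \<open>Density model, risk and minimax rates\<close>

definition prob_densities :: "'a measure \<Rightarrow> ('a \<Rightarrow> real) set" where
  "prob_densities \<nu> =
     {f \<in> borel_measurable \<nu>. (\<forall>x\<in>space \<nu>. 0 \<le> f x) \<and> (\<integral>\<^sup>+ x. ennreal (f x) \<partial>\<nu>) = 1}"

definition admissible_densities :: "'a measure \<Rightarrow> (('a \<Rightarrow> real) \<Rightarrow> ereal) \<Rightarrow> ('a \<Rightarrow> real) set" where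
  "admissible_densities \<nu> \<Phi> = {f \<in> prob_densities \<nu>. \<bar>\<Phi> f\<bar> < \<infinity>}"

definition sample_law :: "'a measure \<Rightarrow> nat \<Rightarrow> ('a \<Rightarrow> real) \<Rightarrow> (nat \<Rightarrow> 'a) measure" where
  "sample_law \<nu> n f = (\<Pi>\<^sub>M i\<in>{..<n}. density \<nu> (\<lambda>x. ennreal (f x)))"

definition estimators :: "'a measure \<Rightarrow> nat \<Rightarrow> ((nat \<Rightarrow> 'a) \<Rightarrow> real) set" where
  "estimators \<nu> n = borel_measurable (\<Pi>\<^sub>M i\<in>{..<n}. \<nu>)"

definition ennreal_sqrt :: "ennreal \<Rightarrow> ennreal" where
  "ennreal_sqrt a = (if a = \<infinity> then \<infinity> else ennreal (sqrt (enn2real a)))"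

definition risk ::
  "'a measure \<Rightarrow> (('a \<Rightarrow> real) \<Rightarrow> ereal) \<Rightarrow> nat \<Rightarrow> ((nat \<Rightarrow> 'a) \<Rightarrow> real) \<Rightarrow> ('a \<Rightarrow> real) set \<Rightarrow> ennreal"
where
  "risk \<nu> \<Phi> n T \<F> =
     (SUP f\<in>\<F>. ennreal_sqrt
        (\<integral>\<^sup>+ x. ennreal ((T x - real_of_ereal (\<Phi> f))\<^sup>2) \<partial>sample_law \<nu> n f))"

definition minimax_risk ::
  "'a measure \<Rightarrow> (('a \<Rightarrow> real) \<Rightarrow> ereal) \<Rightarrow> nat \<Rightarrow> ('a \<Rightarrow> real) set \<Rightarrow> ennreal" where
  "minimax_risk \<nu> \<Phi> n \<F> = (INF T\<in>estimators \<nu> n. risk \<nu> \<Phi> n T \<F>)"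

text \<open>A minimax rate is only determined up to its order, hence a predicate on sequences.\<close>

definition minimax_rate ::
  "'a measure \<Rightarrow> (('a \<Rightarrow> real) \<Rightarrow> ereal) \<Rightarrow> ('a \<Rightarrow> real) set \<Rightarrow> (nat \<Rightarrow> real) \<Rightarrow> bool" where
  "minimax_rate \<nu> \<Phi> \<F> \<phi> \<longleftrightarrow>
     (\<forall>n. 0 < \<phi> n) \<and> \<phi> \<longlonglongrightarrow> 0 \<and>
     0 < liminf (\<lambda>n. minimax_risk \<nu> \<Phi> n \<F> / ennreal (\<phi> n)) \<and>
     limsup (\<lambda>n. minimax_risk \<nu> \<Phi> n \<F> / ennreal (\<phi> n)) < \<infinity>"

definition rate_optimal ::
  "'a measure \<Rightarrow> (('a \<Rightarrow> real) \<Rightarrow> ereal) \<Rightarrow> ('a \<Rightarrow> real) set \<Rightarrow> (nat \<Rightarrow> real) \<Rightarrow>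
   (nat \<Rightarrow> (nat \<Rightarrow> 'a) \<Rightarrow> real) \<Rightarrow> bool" where
  "rate_optimal \<nu> \<Phi> \<F> \<phi> T \<longleftrightarrow>
     (\<forall>n. T n \<in> estimators \<nu> n) \<and>
     limsup (\<lambda>n. risk \<nu> \<Phi> n (T n) \<F> / ennreal (\<phi> n)) < \<infinity>"


section \<open>Adaptive rate of convergence\<close>

definition ball_sets :: "(real ^ 'l) set set" where
  "ball_sets = {B. \<exists>c r. 0 < r \<and> ball c r \<subseteq> B}"

definition topological_manifold :: "nat \<Rightarrow> 'b topology \<Rightarrow> bool" where
  "topological_manifold k X \<longleftrightarrow>
     Hausdorff_space X \<and> second_countable X \<and>
     (\<forall>x\<in>topspace X. \<exists>U V. openin X U \<and> x \<in> U \<and> openin (Euclidean_space k) V \<and>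
        subtopology X U homeomorphic_space subtopology (Euclidean_space k) V)"

text \<open>Manifolds contained in a set carry the topology induced from the ambient space.\<close>

definition hypermanifolds :: "(real ^ 'l) set \<Rightarrow> (real ^ 'l) set set" where
  "hypermanifolds B =
     {T. T \<subseteq> B \<and> topological_manifold (CARD('l) - 1) (top_of_set T)}"

definition normalization_family :: "'t set \<Rightarrow> ('t \<Rightarrow> nat \<Rightarrow> real) \<Rightarrow> bool" where
  "normalization_family \<Theta>\<^sub>r \<mu> \<longleftrightarrow> (\<forall>\<theta>\<in>\<Theta>\<^sub>r. \<forall>n. 0 < \<mu> \<theta> n)"

definition admissible_families ::
  "'a measure \<Rightarrow> (('a \<Rightarrow> real) \<Rightarrow> ereal) \<Rightarrow> 't set \<Rightarrow> 'c set \<Rightarrow> ('t \<Rightarrow> 'c \<Rightarrow> ('a \<Rightarrow> real) set) \<Rightarrow>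
   ('t \<Rightarrow> nat \<Rightarrow> real) set" where
  "admissible_families \<nu> \<Phi> \<Theta>\<^sub>r \<Theta>\<^sub>c F =
     {\<mu>. normalization_family \<Theta>\<^sub>r \<mu> \<and>
        (\<exists>T. (\<forall>n. T n \<in> estimators \<nu> n) \<and>
          (\<forall>\<theta>\<in>\<Theta>\<^sub>r. \<forall>\<eta>\<in>\<Theta>\<^sub>c.
             limsup (\<lambda>n. risk \<nu> \<Phi> n (T n) (F \<theta> \<eta>) / ennreal (\<mu> \<theta> n)) < \<infinity>))}"

text \<open>
  Orders of convergence are compared under the usual convention that one of the two dominates
  the other or that they coincide.
\<close>

definition comparable_orders :: "(nat \<Rightarrow> real) \<Rightarrow> (nat \<Rightarrow> real) \<Rightarrow> bool" where
  "comparable_orders a b \<longleftrightarrow> a \<in> o(b) \<or> b \<in> o(a) \<or> a \<in> \<Theta>(b)"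

text \<open>
  Under this convention an infinite limes superior means that \<open>\<mu> \<theta>\<close> is of smaller order than
  \<open>\<psi> \<theta>\<close>. Without it the notion of an adaptive rate degenerates: if \<open>\<mu>\<close> and \<open>\<psi>\<close> are
  admissible, so is the family equal to \<open>\<mu>\<close> for \<open>n\<close> in an arbitrary infinite set and to \<open>\<psi>\<close>
  for all other \<open>n\<close>; its quotients with \<open>\<psi>\<close> may be unbounded at some parameter although at all
  parameters they are 1 infinitely often, so their products could not tend to 0.
\<close>

definition Theta_minus :: "'t set \<Rightarrow> ('t \<Rightarrow> nat \<Rightarrow> real) \<Rightarrow> ('t \<Rightarrow> nat \<Rightarrow> real) \<Rightarrow> 't set" where
  "Theta_minus \<Theta>\<^sub>r \<psi> \<mu> =
     {\<theta>\<in>\<Theta>\<^sub>r. comparable_orders (\<psi> \<theta>) (\<mu> \<theta>) \<and>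
              limsup (\<lambda>n. ennreal (\<psi> \<theta> n / \<mu> \<theta> n)) = \<infinity>}"

definition adaptive_rate ::
  "'a measure \<Rightarrow> (('a \<Rightarrow> real) \<Rightarrow> ereal) \<Rightarrow> (real ^ 'l) set \<Rightarrow> 'c set \<Rightarrow>
   (real ^ 'l \<Rightarrow> 'c \<Rightarrow> ('a \<Rightarrow> real) set) \<Rightarrow> (real ^ 'l \<Rightarrow> nat \<Rightarrow> real) \<Rightarrow> bool" where
  "adaptive_rate \<nu> \<Phi> \<Theta>\<^sub>r \<Theta>\<^sub>c F \<psi> \<longleftrightarrow>
     \<psi> \<in> admissible_families \<nu> \<Phi> \<Theta>\<^sub>r \<Theta>\<^sub>c F \<and>
     (\<forall>\<mu>\<in>admissible_families \<nu> \<Phi> \<Theta>\<^sub>r \<Theta>\<^sub>c F.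
        (\<exists>T\<in>hypermanifolds \<Theta>\<^sub>r. Theta_minus \<Theta>\<^sub>r \<psi> \<mu> \<subseteq> T) \<and>
        (\<forall>\<theta>\<in>Theta_minus \<Theta>\<^sub>r \<psi> \<mu>. \<exists>A\<subseteq>\<Theta>\<^sub>r. (\<exists>B\<in>ball_sets. B \<subseteq> A) \<and>
           (\<forall>\<theta>'\<in>A. limsup (\<lambda>n. ennreal (\<psi> \<theta>' n / \<mu> \<theta>' n * (\<psi> \<theta> n / \<mu> \<theta> n))) = 0)))"

definition price_to_pay ::
  "'a measure \<Rightarrow> (('a \<Rightarrow> real) \<Rightarrow> ereal) \<Rightarrow> (real ^ 'l) set \<Rightarrow> 'c set \<Rightarrow>
   (real ^ 'l \<Rightarrow> 'c \<Rightarrow> ('a \<Rightarrow> real) set) \<Rightarrow> (real ^ 'l \<Rightarrow> nat \<Rightarrow> real) \<Rightarrow>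
   (real ^ 'l \<Rightarrow> nat \<Rightarrow> real) \<Rightarrow> (nat \<Rightarrow> ennreal) \<Rightarrow> bool"
where
  "price_to_pay \<nu> \<Phi> \<Theta>\<^sub>r \<Theta>\<^sub>c F \<phi> \<psi> p \<longleftrightarrow>
     adaptive_rate \<nu> \<Phi> \<Theta>\<^sub>r \<Theta>\<^sub>c F \<psi> \<and>
     (\<forall>\<theta>\<in>\<Theta>\<^sub>r. \<forall>\<eta>\<in>\<Theta>\<^sub>c. minimax_rate \<nu> \<Phi> (F \<theta> \<eta>) (\<phi> \<theta>)) \<and>
     (\<forall>n. p n = (SUP \<theta>\<in>\<Theta>\<^sub>r. ennreal (\<psi> \<theta> n / \<phi> \<theta> n)))"

definition Theta_plus :: "'t set \<Rightarrow> ('t \<Rightarrow> nat \<Rightarrow> real) \<Rightarrow> 't \<Rightarrow> 't set" where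
  "Theta_plus \<Theta>\<^sub>r \<phi> \<theta> = {\<theta>'\<in>\<Theta>\<^sub>r. limsup (\<lambda>n. ennreal (\<phi> \<theta>' n / \<phi> \<theta> n)) = 0}"

definition Theta_zero :: "'t set \<Rightarrow> ('t \<Rightarrow> nat \<Rightarrow> real) \<Rightarrow> 't \<Rightarrow> 't set" where
  "Theta_zero \<Theta>\<^sub>r \<phi> \<theta> =
     {\<theta>'\<in>\<Theta>\<^sub>r. 0 < liminf (\<lambda>n. ennreal (\<phi> \<theta>' n / \<phi> \<theta> n)) \<and>
              limsup (\<lambda>n. ennreal (\<phi> \<theta>' n / \<phi> \<theta> n)) < \<infinity>}"


section \<open>Parameterized families of densities\<close>

definition lam :: "'a measure \<Rightarrow> (nat \<Rightarrow> 'a \<Rightarrow> real) \<Rightarrow> nat \<Rightarrow> real" where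
  "lam \<nu> \<Lambda> m = (\<integral>x. \<Lambda> m x \<partial>\<nu>)"

definition rho :: "'a measure \<Rightarrow> nat \<Rightarrow> (nat \<Rightarrow> 'a \<Rightarrow> real) \<Rightarrow> (nat \<Rightarrow> real) \<Rightarrow> real" where
  "rho \<nu> M \<Lambda> y = (\<Sum>m=1..M. y m * lam \<nu> \<Lambda> m)"

definition f_par ::
  "'a measure \<Rightarrow> ('a \<Rightarrow> real) \<Rightarrow> nat \<Rightarrow> (nat \<Rightarrow> 'a \<Rightarrow> real) \<Rightarrow> (nat \<Rightarrow> real) \<Rightarrow> 'a \<Rightarrow> real" where
  "f_par \<nu> f0 M \<Lambda> y x = (1 - rho \<nu> M \<Lambda> y) * f0 x + (\<Sum>m=1..M. y m * \<Lambda> m x)"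

text \<open>Off the support of \<open>\<Lambda> m\<close> the integrand is 0, also where \<open>f0\<close> vanishes.\<close>

definition S_par :: "'a measure \<Rightarrow> ('a \<Rightarrow> real) \<Rightarrow> (nat \<Rightarrow> 'a \<Rightarrow> real) \<Rightarrow> nat \<Rightarrow> real" where
  "S_par \<nu> f0 \<Lambda> m = (\<integral>x. (\<Lambda> m x)\<^sup>2 / f0 x \<partial>\<nu>)"

definition Sigma_par :: "'a measure \<Rightarrow> nat \<Rightarrow> (nat \<Rightarrow> 'a \<Rightarrow> real) \<Rightarrow> real measure \<Rightarrow> real" where
  "Sigma_par \<nu> M \<Lambda> P = (\<integral>u. u \<partial>P) * (\<Sum>m=1..M. lam \<nu> \<Lambda> m)"

definition Sup_par :: "'a measure \<Rightarrow> nat \<Rightarrow> (nat \<Rightarrow> 'a \<Rightarrow> real) \<Rightarrow> real" where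
  "Sup_par \<nu> M \<Lambda> = (MAX m\<in>{1..M}. \<bar>lam \<nu> \<Lambda> m\<bar>)"

definition cube :: "real set \<Rightarrow> nat \<Rightarrow> (nat \<Rightarrow> real) set" where
  "cube Y M = {1..M} \<rightarrow>\<^sub>E Y"

definition power_law :: "real measure \<Rightarrow> nat \<Rightarrow> (nat \<Rightarrow> real) measure" where
  "power_law P M = (\<Pi>\<^sub>M m\<in>{1..M}. P)"

definition cube_plus ::
  "'a measure \<Rightarrow> ('a \<Rightarrow> real) \<Rightarrow> nat \<Rightarrow> (nat \<Rightarrow> 'a \<Rightarrow> real) \<Rightarrow> real set \<Rightarrow> (nat \<Rightarrow> real) set" where
  "cube_plus \<nu> f0 M \<Lambda> Y = {y\<in>cube Y M. 0 \<le> (INF x\<in>space \<nu>. ereal (f_par \<nu> f0 M \<Lambda> y x))}"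

definition parameterized_family ::
  "'a measure \<Rightarrow> (('a \<Rightarrow> real) \<Rightarrow> ereal) \<Rightarrow> ('a \<Rightarrow> real) \<Rightarrow> nat \<Rightarrow> (nat \<Rightarrow> 'a \<Rightarrow> real) \<Rightarrow>
   real set \<Rightarrow> real measure \<Rightarrow> bool" where
  "parameterized_family \<nu> \<Phi> f0 M \<Lambda> Y P \<longleftrightarrow>
     f0 \<in> admissible_densities \<nu> \<Phi> \<and> 1 \<le> M \<and>
     (\<forall>m\<in>{1..M}. \<Lambda> m \<in> borel_measurable \<nu> \<and> integrable \<nu> (\<lambda>x. (\<Lambda> m x)\<^sup>2) \<and>
        integrable \<nu> (\<Lambda> m) \<and> integrable \<nu> (\<lambda>x. (\<Lambda> m x)\<^sup>2 / f0 x)) \<and>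
     is_interval Y \<and> prob_space P \<and> sets P = sets (restrict_space borel Y)"

definition disjoint_supports :: "'a measure \<Rightarrow> nat \<Rightarrow> (nat \<Rightarrow> 'a \<Rightarrow> real) \<Rightarrow> (nat \<Rightarrow> 'a set) \<Rightarrow> bool"
where
  "disjoint_supports \<nu> M \<Lambda> D \<longleftrightarrow>
     (\<forall>m\<in>{1..M}. D m \<in> sets \<nu> \<and> support_on (space \<nu>) (\<Lambda> m) = D m) \<and>
     disjoint_family_on D {1..M}"

definition positive_base :: "('a \<Rightarrow> real) set \<Rightarrow> ('a \<Rightarrow> real) \<Rightarrow> nat \<Rightarrow> (nat \<Rightarrow> 'a set) \<Rightarrow> bool" where
  "positive_base \<F> f0 M D \<longleftrightarrow> f0 \<in> \<F> \<and> (\<forall>x\<in>(\<Union>m\<in>{1..M}. D m). 0 < f0 x)"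

text \<open>
  \<^const>\<open>measure\<close> is 0 on non-measurable sets, so the two lower bounds below include the
  measurability of the events.
\<close>

definition mostly_in_class ::
  "'a measure \<Rightarrow> ('a \<Rightarrow> real) set \<Rightarrow> ('a \<Rightarrow> real) \<Rightarrow> nat \<Rightarrow> (nat \<Rightarrow> 'a \<Rightarrow> real) \<Rightarrow>
   real set \<Rightarrow> real measure \<Rightarrow> bool" where
  "mostly_in_class \<nu> \<F> f0 M \<Lambda> Y P \<longleftrightarrow>
     measure (power_law P M) {y\<in>cube Y M. f_par \<nu> f0 M \<Lambda> y \<in> \<F>} \<ge> 230 / 231"

definition mostly_separated ::
  "'a measure \<Rightarrow> (('a \<Rightarrow> real) \<Rightarrow> ereal) \<Rightarrow> real \<Rightarrow> ('a \<Rightarrow> real) \<Rightarrow> nat \<Rightarrow> (nat \<Rightarrow> 'a \<Rightarrow> real) \<Rightarrow>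
   real set \<Rightarrow> real measure \<Rightarrow> bool" where
  "mostly_separated \<nu> \<Phi> s f0 M \<Lambda> Y P \<longleftrightarrow>
     measure (power_law P M)
       {y\<in>cube Y M. \<bar>\<Phi> (f_par \<nu> f0 M \<Lambda> y) - \<Phi> f0\<bar> > ereal (2 * s)} \<ge> 230 / 231"

definition centered_case ::
  "'a measure \<Rightarrow> ('a \<Rightarrow> real) \<Rightarrow> nat \<Rightarrow> (nat \<Rightarrow> 'a \<Rightarrow> real) \<Rightarrow> real set \<Rightarrow> bool" where
  "centered_case \<nu> f0 M \<Lambda> Y \<longleftrightarrow>
     (\<forall>m\<in>{1..M}. lam \<nu> \<Lambda> m = 0) \<and> cube_plus \<nu> f0 M \<Lambda> Y = cube Y M"

definition nonneg_case :: "'a measure \<Rightarrow> nat \<Rightarrow> (nat \<Rightarrow> 'a \<Rightarrow> real) \<Rightarrow> real set \<Rightarrow> bool" where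
  "nonneg_case \<nu> M \<Lambda> Y \<longleftrightarrow>
     cube Y M \<subseteq> cube {0..1} M \<and> (\<forall>m\<in>{1..M}. \<forall>x\<in>space \<nu>. 0 \<le> \<Lambda> m x)"

definition small_masses ::
  "'a measure \<Rightarrow> nat \<Rightarrow> nat \<Rightarrow> (nat \<Rightarrow> 'a \<Rightarrow> real) \<Rightarrow> real measure \<Rightarrow> bool" where
  "small_masses \<nu> n M \<Lambda> P \<longleftrightarrow>
     Sigma_par \<nu> M \<Lambda> P \<le> 0.25 \<and> 256 * (Sup_par \<nu> M \<Lambda>)\<^sup>2 * real M * real n \<le> 1"

text \<open>
  All elements of the construction may depend on the sample size. \<open>\<F>\<close> is the class containing
  the base densities, \<open>\<G>\<close> (with minimax rate \<open>\<phi>\<close>) the class most perturbations belong to.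
\<close>

definition lower_bound_conditions ::
  "'a measure \<Rightarrow> (('a \<Rightarrow> real) \<Rightarrow> ereal) \<Rightarrow> ('a \<Rightarrow> real) set \<Rightarrow> ('a \<Rightarrow> real) set \<Rightarrow>
   (nat \<Rightarrow> real) \<Rightarrow> (nat \<Rightarrow> real) \<Rightarrow> (nat \<Rightarrow> 'a \<Rightarrow> real) \<Rightarrow> (nat \<Rightarrow> nat) \<Rightarrow>
   (nat \<Rightarrow> nat \<Rightarrow> 'a \<Rightarrow> real) \<Rightarrow> (nat \<Rightarrow> real set) \<Rightarrow> (nat \<Rightarrow> real measure) \<Rightarrow> bool" where
  "lower_bound_conditions \<nu> \<Phi> \<F> \<G> \<phi> \<psi> f0 M \<Lambda> Y P \<longleftrightarrow>
     (\<forall>n. parameterized_family \<nu> \<Phi> (f0 n) (M n) (\<Lambda> n) (Y n) (P n)) \<and>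
     (\<forall>n. \<exists>D. disjoint_supports \<nu> (M n) (\<Lambda> n) D \<and> positive_base \<F> (f0 n) (M n) D) \<and>
     (\<forall>n. mostly_in_class \<nu> \<G> (f0 n) (M n) (\<Lambda> n) (Y n) (P n)) \<and>
     (\<psi> \<longlonglongrightarrow> 0 \<and> filterlim (\<lambda>n. \<psi> n / \<phi> n) at_top sequentially \<and>
      (\<forall>\<^sub>F n in sequentially. mostly_separated \<nu> \<Phi> (\<psi> n) (f0 n) (M n) (\<Lambda> n) (Y n) (P n))) \<and>
     ((\<forall>n. centered_case \<nu> (f0 n) (M n) (\<Lambda> n) (Y n)) \<or>
      (\<forall>n. nonneg_case \<nu> (M n) (\<Lambda> n) (Y n)) \<and>
      (\<forall>\<^sub>F n in sequentially. small_masses \<nu> n (M n) (\<Lambda> n) (P n)))"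

definition exp_moment_product ::
  "'a measure \<Rightarrow> real \<Rightarrow> nat \<Rightarrow> ('a \<Rightarrow> real) \<Rightarrow> nat \<Rightarrow> (nat \<Rightarrow> 'a \<Rightarrow> real) \<Rightarrow> real measure \<Rightarrow> ennreal"
where
  "exp_moment_product \<nu> i n f0 M \<Lambda> P =
     (\<Prod>m=1..M. \<integral>\<^sup>+ (u, v). ennreal (exp (i * real n * S_par \<nu> f0 \<Lambda> m * u * v)) \<partial>(P \<Otimes>\<^sub>M P))"

definition alpha :: "('t \<Rightarrow> nat \<Rightarrow> real) \<Rightarrow> ('t \<Rightarrow> 't \<Rightarrow> real) \<Rightarrow> 't \<Rightarrow> 't \<Rightarrow> nat \<Rightarrow> real" where
  "alpha \<phi> c \<theta> \<theta>' n = \<phi> \<theta> n / (\<phi> \<theta>' n) powr c \<theta> \<theta>'"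

end

theory Submission
  imports Defs
begin

text \<open>
  Let \<open>\<theta> \<in> Theta_minus\<close>, so that \<open>\<mu> \<theta>\<close> is of smaller order than \<open>\<psi> \<theta>\<close>, and let \<open>\<theta>'\<close> belong to
  \<open>Theta_plus \<theta>\<close>. On the densities \<open>f_y\<close> in the class of \<open>\<theta>\<close> that are separated from \<open>f0\<close>, the
  estimator attaining \<open>\<mu>\<close> is within \<open>\<psi> \<theta>\<close> of \<open>\<Phi> f_y\<close>, hence off \<open>\<Phi> f0\<close> by at least \<open>\<psi> \<theta>\<close>, with
  probability near 1. The second moment under \<open>f0\<close> of the likelihood ratio of their mixture is at
  most \<open>\<Prod>\<^sub>m \<integral>\<integral> exp (n S\<^sub>m u v)\<close>, which is \<open>o(\<alpha>\<^sup>2)\<close>, so this event keeps probability at least of order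
  \<open>1 / o(\<alpha>\<^sup>2)\<close> under \<open>f0\<close>, and \<open>\<psi> \<theta> = o(\<mu> \<theta>' \<cdot> \<alpha>)\<close>. Restricting the mixture to \<open>f_y\<close> that are densities
  keeps all integrands nonnegative, and then \<open>\<integral> f_y f_z / f0 = 1 - \<rho>\<^sub>y \<rho>\<^sub>z + \<Sum>\<^sub>m y\<^sub>m z\<^sub>m S\<^sub>m\<close> with
  \<open>\<rho>\<^sub>y \<rho>\<^sub>z \<ge> 0\<close> in both cases of condition (5). Together with \<open>\<phi> \<theta> = O(\<mu> \<theta>)\<close> and (A3) this gives
  \<open>(\<psi> \<theta>' / \<mu> \<theta>') (\<psi> \<theta> / \<mu> \<theta>) \<rightarrow> 0\<close>. Two elements of \<open>Theta_minus\<close> can therefore not be ordered by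
  \<open>Theta_plus\<close>, so by comparability \<open>Theta_minus\<close> lies in \<open>Theta_zero\<close> of any of its elements.
\<close>

section \<open>Densities of product measures and likelihood ratios of samples\<close>

lemma product_sigma_finite_const_prob:
  assumes "prob_space N" shows "product_sigma_finite (\<lambda>_. N)"
  using assms by (simp add: product_sigma_finite_def prob_space_imp_sigma_finite)

text \<open>On a rectangle the integral of the product density splits into one-dimensional
  integrals, and the values on rectangles determine a product measure.\<close>

lemma PiM_density_const:
  fixes N :: "'a measure" and I :: "'i set"
  assumes "finite I" "prob_space N" "g \<in> borel_measurable N" "prob_space (density N g)"
  shows "(\<Pi>\<^sub>M i\<in>I. density N g) = density (\<Pi>\<^sub>M i\<in>I. N) (\<lambda>x. \<Prod>i\<in>I. g (x i))"
proof -
  interpret N: product_sigma_finite "\<lambda>_::'i. N"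
    by (rule product_sigma_finite_const_prob) fact
  interpret D: product_sigma_finite "\<lambda>_::'i. density N g"
    by (rule product_sigma_finite_const_prob) fact
  note [measurable] = assms(3)
  show ?thesis
  proof (rule D.PiM_eqI[symmetric])
    show "sets (density (\<Pi>\<^sub>M i\<in>I. N) (\<lambda>x. \<Prod>i\<in>I. g (x i))) = sets (\<Pi>\<^sub>M i\<in>I. density N g)"
      by (auto intro!: sets_PiM_cong)
    fix A assume A: "\<And>i. i \<in> I \<Longrightarrow> A i \<in> sets (density N g)"
    then have AN[measurable]: "i \<in> I \<Longrightarrow> A i \<in> sets N" for i by simp
    have sub: "Pi\<^sub>E I A \<in> sets (\<Pi>\<^sub>M i\<in>I. N)" using AN \<open>finite I\<close> by (auto intro!: sets_PiM_I_finite)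
    have "emeasure (density (\<Pi>\<^sub>M i\<in>I. N) (\<lambda>x. \<Prod>i\<in>I. g (x i))) (Pi\<^sub>E I A)
        = (\<integral>\<^sup>+x. (\<Prod>i\<in>I. g (x i)) * indicator (Pi\<^sub>E I A) x \<partial>(\<Pi>\<^sub>M i\<in>I. N))"
      using sub by (subst emeasure_density) auto
    also have "\<dots> = (\<integral>\<^sup>+x. (\<Prod>i\<in>I. g (x i) * indicator (A i) (x i)) \<partial>(\<Pi>\<^sub>M i\<in>I. N))"
      using \<open>finite I\<close> 
      by (intro nn_integral_cong)
        (auto simp: prod.distrib indicator_def PiE_iff space_PiM intro!: prod.neutral[symmetric])
    also have "\<dots> = (\<Prod>i\<in>I. \<integral>\<^sup>+x. g x * indicator (A i) x \<partial>N)"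
      using \<open>finite I\<close> AN by (subst N.product_nn_integral_prod) auto
    also have "\<dots> = (\<Prod>i\<in>I. emeasure (density N g) (A i))"
      using AN by (auto intro!: prod.cong simp: emeasure_density)
    finally show "emeasure (density (\<Pi>\<^sub>M i\<in>I. N) (\<lambda>x. \<Prod>i\<in>I. g (x i))) (Pi\<^sub>E I A)
        = (\<Prod>i\<in>I. emeasure (density N g) (A i))" .
  qed fact+
qed

lemma prob_space_density_of_prob_densities:
  assumes "f \<in> prob_densities \<nu>"
  shows "prob_space (density \<nu> (\<lambda>x. ennreal (f x)))"
proof
  have [measurable]: "f \<in> borel_measurable \<nu>" using assms by (simp add: prob_densities_def)
  show "emeasure (density \<nu> (\<lambda>x. ennreal (f x))) (space (density \<nu> (\<lambda>x. ennreal (f x)))) = 1"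
    using assms by (simp add: emeasure_density prob_densities_def cong: nn_integral_cong)
qed

text \<open>Since \<open>f\<close> vanishes wherever \<open>f0\<close> does,
  \<open>f0 * (f / f0) = f\<close> holds pointwise, including the points where the quotient is 0 by
  convention.\<close>

lemma density_ratio:
  assumes f: "f \<in> prob_densities \<nu>" and f0: "f0 \<in> prob_densities \<nu>"
    and ac: "\<And>x. x \<in> space \<nu> \<Longrightarrow> f0 x = 0 \<Longrightarrow> f x = 0"
  shows "density \<nu> (\<lambda>x. ennreal (f x))
    = density (density \<nu> (\<lambda>x. ennreal (f0 x))) (\<lambda>x. ennreal (f x / f0 x))"
proof -
  have [measurable]: "f \<in> borel_measurable \<nu>" "f0 \<in> borel_measurable \<nu>"
    using f f0 by (simp_all add: prob_densities_def)
  have "density (density \<nu> (\<lambda>x. ennreal (f0 x))) (\<lambda>x. ennreal (f x / f0 x))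
     = density \<nu> (\<lambda>x. ennreal (f0 x) * ennreal (f x / f0 x))"
    by (rule density_density_eq) auto
  also have "\<dots> = density \<nu> (\<lambda>x. ennreal (f x))"
  proof (intro density_cong)
    show "AE x in \<nu>. ennreal (f0 x) * ennreal (f x / f0 x) = ennreal (f x)"
    proof (rule AE_I2)
      fix x assume x: "x \<in> space \<nu>"
      have "0 \<le> f0 x" "0 \<le> f x" using f f0 x by (auto simp: prob_densities_def)
      then show "ennreal (f0 x) * ennreal (f x / f0 x) = ennreal (f x)"
        using ac[OF x] by (cases "f0 x = 0") (auto simp flip: ennreal_mult)
    qed
  qed auto
  finally show ?thesis by simp
qed

text \<open>Independence turns the one-observation ratio \<open>f / f0\<close> into a product: the
  likelihood ratio of the whole sample against \<open>f0\<close>.\<close>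

lemma sample_law_ratio:
  assumes f: "f \<in> prob_densities \<nu>" and f0: "f0 \<in> prob_densities \<nu>"
    and ac: "\<And>x. x \<in> space \<nu> \<Longrightarrow> f0 x = 0 \<Longrightarrow> f x = 0"
  shows "sample_law \<nu> n f
    = density (sample_law \<nu> n f0) (\<lambda>x. \<Prod>i<n. ennreal (f (x i) / f0 (x i)))"
proof -
  have [measurable]: "f \<in> borel_measurable \<nu>" "f0 \<in> borel_measurable \<nu>"
    using f f0 by (simp_all add: prob_densities_def)
  let ?g = "\<lambda>x. ennreal (f x / f0 x)"
  have eq: "density \<nu> (\<lambda>x. ennreal (f x)) = density (density \<nu> (\<lambda>x. ennreal (f0 x))) ?g"
    by (rule density_ratio[OF f f0 ac])
  have "(\<Pi>\<^sub>M i\<in>{..<n}. density (density \<nu> (\<lambda>x. ennreal (f0 x))) ?g)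
      = density (\<Pi>\<^sub>M i\<in>{..<n}. density \<nu> (\<lambda>x. ennreal (f0 x))) (\<lambda>x. \<Prod>i<n. ?g (x i))"
    using prob_space_density_of_prob_densities[OF f] eq
    by (intro PiM_density_const prob_space_density_of_prob_densities[OF f0]) auto
  then show ?thesis by (simp only: sample_law_def eq)
qed

section \<open>Cross moments of likelihood ratios in the parameterized family\<close>

lemma disjoint_supportsD:
  assumes "disjoint_supports \<nu> M \<Lambda> D" "m \<in> {1..M}" "x \<in> space \<nu>" "\<Lambda> m x \<noteq> 0"
  shows "x \<in> D m"
proof -
  have "support_on (space \<nu>) (\<Lambda> m) = D m"
    using assms(1,2) by (simp add: disjoint_supports_def)
  then show ?thesis using assms(3,4) by (auto simp: support_on_def)
qed

text \<open>This makes every \<open>f_par\<close> density absolutely continuous with respect to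
  \<open>f0\<close> and makes the quotients by \<open>f0\<close> harmless at its zeros.\<close>

lemma perturbation_zero_off_base:
  assumes ds: "disjoint_supports \<nu> M \<Lambda> D" and pb: "positive_base \<F> f0 M D"
    and x: "x \<in> space \<nu>" "f0 x = 0" and m: "m \<in> {1..M}"
  shows "\<Lambda> m x = 0"
proof (rule ccontr)
  assume "\<Lambda> m x \<noteq> 0"
  then have "x \<in> (\<Union>m\<in>{1..M}. D m)" using disjoint_supportsD[OF ds m x(1)] m by blast
  then have "0 < f0 x" using pb unfolding positive_base_def by blast
  then show False using x by simp
qed

text \<open>At any point at most one of the functions \<Lambda> is nonzero, so only the diagonal of
  the double sum survives.\<close>

lemma sum_mult_disjoint:
  fixes a b :: "nat \<Rightarrow> real"
  assumes ds: "disjoint_supports \<nu> M \<Lambda> D" and x: "x \<in> space \<nu>"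
  shows "(\<Sum>m=1..M. a m * \<Lambda> m x) * (\<Sum>m=1..M. b m * \<Lambda> m x) = (\<Sum>m=1..M. a m * b m * (\<Lambda> m x)\<^sup>2)"
proof -
  have z: "\<Lambda> m x * \<Lambda> k x = 0" if mk: "m \<in> {1..M}" "k \<in> {1..M}" "m \<noteq> k" for m k
  proof (rule ccontr)
    assume "\<Lambda> m x * \<Lambda> k x \<noteq> 0"
    then have "x \<in> D m" "x \<in> D k"
      using disjoint_supportsD[OF ds _ x] mk by auto
    moreover have "disjoint_family_on D {1..M}" using ds by (simp add: disjoint_supports_def)
    ultimately show False using disjoint_family_onD[OF _ mk] by blast
  qed
  have "(\<Sum>m=1..M. a m * \<Lambda> m x) * (\<Sum>m=1..M. b m * \<Lambda> m x)
      = (\<Sum>m=1..M. \<Sum>k=1..M. a m * b k * (\<Lambda> m x * \<Lambda> k x))"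
    unfolding sum_product by (intro sum.cong refl) (simp only: mult_ac)
  also have "\<dots> = (\<Sum>m=1..M. \<Sum>k=1..M. if k = m then a m * b m * (\<Lambda> m x)\<^sup>2 else 0)"
  proof (intro sum.cong refl)
    fix m k assume mk: "m \<in> {1..M}" "k \<in> {1..M}"
    show "a m * b k * (\<Lambda> m x * \<Lambda> k x) = (if k = m then a m * b m * (\<Lambda> m x)\<^sup>2 else 0)"
      using z[OF mk] by (cases "k = m") (simp_all add: power2_eq_square)
  qed
  also have "\<dots> = (\<Sum>m=1..M. a m * b m * (\<Lambda> m x)\<^sup>2)" by simp
  finally show ?thesis .
qed

text \<open>Multiplying out \<open>f_y * f_z / f0\<close> leaves multiples of \<open>f0\<close>, of
  the perturbations and of their squares over \<open>f0\<close>, whose integrals are 1,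
  \<open>lam\<close> and \<open>S_par\<close>. The second claim is recorded because
  \<open>ennreal\<close> would turn a negative value into 0.\<close>

lemma likelihood_pair_integral:
  assumes pf: "parameterized_family \<nu> \<Phi> f0 M \<Lambda> Y P"
    and ds: "disjoint_supports \<nu> M \<Lambda> D" and pb: "positive_base \<F> f0 M D"
    and fy: "f_par \<nu> f0 M \<Lambda> y \<in> prob_densities \<nu>" and fz: "f_par \<nu> f0 M \<Lambda> z \<in> prob_densities \<nu>"
  shows "(\<integral>\<^sup>+x. ennreal (f_par \<nu> f0 M \<Lambda> y x / f0 x) * ennreal (f_par \<nu> f0 M \<Lambda> z x / f0 x)
            \<partial>density \<nu> (\<lambda>x. ennreal (f0 x)))
       = ennreal (1 - rho \<nu> M \<Lambda> y * rho \<nu> M \<Lambda> z + (\<Sum>m=1..M. y m * z m * S_par \<nu> f0 \<Lambda> m))" (is "?l = ennreal ?r")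
    and "0 \<le> 1 - rho \<nu> M \<Lambda> y * rho \<nu> M \<Lambda> z + (\<Sum>m=1..M. y m * z m * S_par \<nu> f0 \<Lambda> m)"
proof -
  let ?f = "f_par \<nu> f0 M \<Lambda>"
  have f0: "f0 \<in> prob_densities \<nu>" using pf by (simp add: parameterized_family_def admissible_densities_def)
  note [measurable] = f0[unfolded prob_densities_def, simplified, THEN conjunct1]
    fy[unfolded prob_densities_def, simplified, THEN conjunct1]
    fz[unfolded prob_densities_def, simplified, THEN conjunct1]
  have nn: "0 \<le> f0 x" "0 \<le> ?f y x" "0 \<le> ?f z x" if "x \<in> space \<nu>" for x
    using f0 fy fz that by (auto simp: prob_densities_def)
  have f0hb: "has_bochner_integral \<nu> f0 1"
    using f0 by (intro has_bochner_integral_nn_integral) (auto simp: prob_densities_def)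
  have Lhb: "has_bochner_integral \<nu> (\<Lambda> m) (lam \<nu> \<Lambda> m)"
    and Shb: "has_bochner_integral \<nu> (\<lambda>x. (\<Lambda> m x)\<^sup>2 / f0 x) (S_par \<nu> f0 \<Lambda> m)" if "m \<in> {1..M}" for m
    using pf that by (auto simp: parameterized_family_def lam_def S_par_def has_bochner_integral_iff)
  let ?a = "1 - rho \<nu> M \<Lambda> y" and ?b = "1 - rho \<nu> M \<Lambda> z"
  let ?h = "\<lambda>x. ?a * ?b * f0 x + ?a * (\<Sum>m=1..M. z m * \<Lambda> m x) + ?b * (\<Sum>m=1..M. y m * \<Lambda> m x)
     + (\<Sum>m=1..M. y m * z m * ((\<Lambda> m x)\<^sup>2 / f0 x))"
  \<comment> \<open>At a zero of \<open>f0\<close> all perturbations vanish and both sides are 0;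
    elsewhere the denominators cancel.\<close>
  have hh: "f0 x * ((?f y x / f0 x) * (?f z x / f0 x)) = ?h x" if x: "x \<in> space \<nu>" for x
  proof (cases "f0 x = 0")
    case True
    then show ?thesis using perturbation_zero_off_base[OF ds pb x True] by simp
  next
    case False
    have "?f y x * ?f z x = ?a * ?b * f0 x * f0 x + ?a * (\<Sum>m=1..M. z m * \<Lambda> m x) * f0 x
       + ?b * (\<Sum>m=1..M. y m * \<Lambda> m x) * f0 x + (\<Sum>m=1..M. y m * z m * (\<Lambda> m x)\<^sup>2)"
      unfolding f_par_def sum_mult_disjoint[OF ds x, symmetric] by (simp add: algebra_simps)
    also have "\<dots> = ?h x * f0 x" using False
      by (simp add: distrib_right sum_distrib_right)
    finally show ?thesis using False by (simp add: field_simps)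
  qed
  have "has_bochner_integral \<nu> ?h
     (?a * ?b * 1 + ?a * (\<Sum>m=1..M. z m * lam \<nu> \<Lambda> m) + ?b * (\<Sum>m=1..M. y m * lam \<nu> \<Lambda> m)
      + (\<Sum>m=1..M. y m * z m * S_par \<nu> f0 \<Lambda> m))"
    by (intro has_bochner_integral_add has_bochner_integral_mult_right has_bochner_integral_sum f0hb Lhb Shb)
  \<comment> \<open>With p and q for the two values of \<open>rho\<close>, this is (1 - p)(1 - q) +
    (1 - p) q + (1 - q) p = 1 - p q.\<close>
  also have "?a * ?b * 1 + ?a * (\<Sum>m=1..M. z m * lam \<nu> \<Lambda> m) + ?b * (\<Sum>m=1..M. y m * lam \<nu> \<Lambda> m)
      + (\<Sum>m=1..M. y m * z m * S_par \<nu> f0 \<Lambda> m) = ?r"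
    by (simp only: rho_def[symmetric]) (simp add: algebra_simps)
  finally have hb: "has_bochner_integral \<nu> ?h ?r" .
  have hnn: "0 \<le> ?h x" if "x \<in> space \<nu>" for x
    unfolding hh[OF that, symmetric] using nn[OF that]
    by (intro mult_nonneg_nonneg divide_nonneg_nonneg)
  have "integral\<^sup>L \<nu> ?h = ?r" by (rule has_bochner_integral_integral_eq[OF hb])
  moreover have "0 \<le> integral\<^sup>L \<nu> ?h" by (rule Bochner_Integration.integral_nonneg) (rule hnn)
  ultimately show r: "0 \<le> ?r" by (simp only:)
  have "?l = (\<integral>\<^sup>+x. ennreal (f0 x) * (ennreal (?f y x / f0 x) * ennreal (?f z x / f0 x)) \<partial>\<nu>)"
    by (subst nn_integral_density) auto
  also have "\<dots> = (\<integral>\<^sup>+x. ennreal (?h x) \<partial>\<nu>)"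
  proof (intro nn_integral_cong)
    fix x assume x: "x \<in> space \<nu>"
    have "ennreal (f0 x) * (ennreal (?f y x / f0 x) * ennreal (?f z x / f0 x))
        = ennreal (f0 x * ((?f y x / f0 x) * (?f z x / f0 x)))"
      using nn[OF x] by (simp only: ennreal_mult mult_nonneg_nonneg divide_nonneg_nonneg)
    then show "ennreal (f0 x) * (ennreal (?f y x / f0 x) * ennreal (?f z x / f0 x)) = ennreal (?h x)"
      by (simp only: hh[OF x])
  qed
  also have "\<dots> = ennreal ?r"
    using hb hnn by (subst nn_integral_eq_integral) (auto simp: has_bochner_integral_iff)
  finally show "?l = ennreal ?r" .
qed

text \<open>The exponential of the sum is a product over the coordinates, which are independent
  under \<open>power_law\<close>, so both integrals factorize.\<close>

lemma exp_moment_product_eq: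
  assumes pf: "parameterized_family \<nu> \<Phi> f0 M \<Lambda> Y P"
  shows "(\<integral>\<^sup>+y. \<integral>\<^sup>+z. ennreal (exp (real n * (\<Sum>m=1..M. y m * z m * S_par \<nu> f0 \<Lambda> m))) \<partial>power_law P M \<partial>power_law P M)
    = exp_moment_product \<nu> 1 n f0 M \<Lambda> P"
proof -
  have pP: "prob_space P" and sP: "sets P = sets (restrict_space borel Y)"
    using pf by (auto simp: parameterized_family_def)
  interpret P: prob_space P by fact
  interpret PP: product_sigma_finite "\<lambda>_::nat. P" by (rule product_sigma_finite_const_prob) fact
  \<comment> \<open>The measurable sets of \<open>P\<close> are the traces of the Borel sets on
    \<open>Y\<close>.\<close>
  have [measurable]: "(\<lambda>x. x) \<in> borel_measurable P"
    unfolding measurable_cong_sets[OF sP refl] by (rule measurable_restrict_space1) auto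
  let ?e = "\<lambda>m u v. ennreal (exp (real n * S_par \<nu> f0 \<Lambda> m * u * v))"
  have "(\<integral>\<^sup>+y. \<integral>\<^sup>+z. ennreal (exp (real n * (\<Sum>m=1..M. y m * z m * S_par \<nu> f0 \<Lambda> m))) \<partial>power_law P M \<partial>power_law P M)
     = (\<integral>\<^sup>+y. \<integral>\<^sup>+z. (\<Prod>m=1..M. ?e m (y m) (z m)) \<partial>power_law P M \<partial>power_law P M)"
    by (intro nn_integral_cong) (simp add: prod_ennreal exp_sum sum_distrib_left mult_ac)
  also have "\<dots> = (\<integral>\<^sup>+y. (\<Prod>m=1..M. \<integral>\<^sup>+v. ?e m (y m) v \<partial>P) \<partial>power_law P M)"
    unfolding power_law_def
    by (intro nn_integral_cong PP.product_nn_integral_prod) auto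
  also have "\<dots> = (\<Prod>m=1..M. \<integral>\<^sup>+u. \<integral>\<^sup>+v. ?e m u v \<partial>P \<partial>P)"
    unfolding power_law_def
    by (intro PP.product_nn_integral_prod) auto
  also have "\<dots> = exp_moment_product \<nu> 1 n f0 M \<Lambda> P"
    unfolding exp_moment_product_def
  proof (intro prod.cong refl)
    fix m
    show "(\<integral>\<^sup>+u. \<integral>\<^sup>+v. ?e m u v \<partial>P \<partial>P)
      = (\<integral>\<^sup>+ (u, v). ennreal (exp (1 * real n * S_par \<nu> f0 \<Lambda> m * u * v)) \<partial>(P \<Otimes>\<^sub>M P))"
      by (subst P.nn_integral_fst[symmetric]) auto
  qed
  finally show ?thesis .
qed

text \<open>The correction \<open>?q\<close> is nonnegative, so one observation contributes at most
  1 + s, which is at most exp s; n observations give the n-th power.\<close>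

lemma likelihood_pair_integral_le_exp:
  assumes pf: "parameterized_family \<nu> \<Phi> f0 M \<Lambda> Y P"
    and ds: "disjoint_supports \<nu> M \<Lambda> D" and pb: "positive_base \<F> f0 M D"
    and cases: "centered_case \<nu> f0 M \<Lambda> Y \<or> nonneg_case \<nu> M \<Lambda> Y"
    and y: "y \<in> cube Y M" "f_par \<nu> f0 M \<Lambda> y \<in> prob_densities \<nu>"
    and z: "z \<in> cube Y M" "f_par \<nu> f0 M \<Lambda> z \<in> prob_densities \<nu>"
  shows "(\<integral>\<^sup>+x. ennreal (f_par \<nu> f0 M \<Lambda> y x / f0 x) * ennreal (f_par \<nu> f0 M \<Lambda> z x / f0 x)
            \<partial>density \<nu> (\<lambda>x. ennreal (f0 x))) ^ n
       \<le> ennreal (exp (real n * (\<Sum>m=1..M. y m * z m * S_par \<nu> f0 \<Lambda> m)))"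
proof -
  let ?s = "\<Sum>m=1..M. y m * z m * S_par \<nu> f0 \<Lambda> m"
  let ?q = "rho \<nu> M \<Lambda> y * rho \<nu> M \<Lambda> z"
  have "0 \<le> ?q"
    using cases
  proof
    assume "centered_case \<nu> f0 M \<Lambda> Y"
    then show ?thesis by (simp add: centered_case_def rho_def)
  next
    assume nn: "nonneg_case \<nu> M \<Lambda> Y"
    have "0 \<le> rho \<nu> M \<Lambda> w" if "w \<in> cube Y M" for w
      unfolding rho_def
    proof (intro sum_nonneg mult_nonneg_nonneg)
      fix m assume m: "m \<in> {1..M}"
      have "w \<in> cube {0..1} M" using nn that by (auto simp: nonneg_case_def)
      then show "0 \<le> w m" using m by (auto simp: cube_def PiE_iff)
      show "0 \<le> lam \<nu> \<Lambda> m"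
        unfolding lam_def using nn m by (intro Bochner_Integration.integral_nonneg) (simp add: nonneg_case_def)
    qed
    then show ?thesis using y z by simp
  qed
  \<comment> \<open>Monotonicity of the power needs a nonnegative base, supplied by the second claim
    about the pair integral.\<close>
  have "(1 - ?q + ?s) ^ n \<le> exp ?s ^ n"
    using likelihood_pair_integral(2)[OF pf ds pb y(2) z(2)] \<open>0 \<le> ?q\<close> exp_ge_add_one_self[of ?s]
    by (intro power_mono) linarith+
  also have "\<dots> = exp (real n * ?s)" by (simp add: exp_of_nat_mult)
  finally show ?thesis
    using likelihood_pair_integral[OF pf ds pb y(2) z(2)] by (simp add: ennreal_power ennreal_leI)
qed

section \<open>Second-moment bound for mixtures of sample laws\<close>

text \<open>For finite values this is the nonnegativity of (a - t)^2 over the reals; if one value is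
  infinite, so is the right-hand side.\<close>

lemma ennreal_sum_squares_bound: "2 * t * a \<le> a * a + t\<^sup>2" for a t :: ennreal
proof (cases "a = \<infinity> \<or> t = \<infinity>")
  case True
  then show ?thesis by (auto simp: power2_eq_square ennreal_top_mult)
next
  case False
  then obtain x y where xy: "a = ennreal x" "t = ennreal y" "0 \<le> x" "0 \<le> y"
    by (metis ennreal_cases infinity_ennreal_def)
  have "2 * y * x \<le> x * x + y\<^sup>2"
    using sum_squares_bound[of y x] by (simp add: power2_eq_square)
  then have "ennreal (2 * y * x) \<le> ennreal (x * x + y\<^sup>2)" by (rule ennreal_leI)
  then show ?thesis using xy
    by (simp add: ennreal_mult ennreal_plus power2_eq_square)
qed

text \<open>Integrate 2 t L \<le> L^2 + t^2 over the event, where L is the likelihood ratio of the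
  mixture over \<open>G\<close>. The free parameter \<open>t\<close> replaces the Cauchy-Schwarz
  inequality and keeps the bound linear in the probability of \<open>A\<close> under
  \<open>f0\<close>.\<close>

lemma mixture_testing_bound:
  fixes t b :: ennreal
  assumes pf: "parameterized_family \<nu> \<Phi> f0 M \<Lambda> Y P"
    and ds: "disjoint_supports \<nu> M \<Lambda> D" and pb: "positive_base \<F> f0 M D"
    and cases: "centered_case \<nu> f0 M \<Lambda> Y \<or> nonneg_case \<nu> M \<Lambda> Y"
    and G: "G \<in> sets (power_law P M)" "G \<subseteq> cube Y M"
      "\<And>y. y \<in> G \<Longrightarrow> f_par \<nu> f0 M \<Lambda> y \<in> prob_densities \<nu>"
    and A: "A \<in> sets (\<Pi>\<^sub>M i\<in>{..<n}. \<nu>)"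
    and b: "\<And>y. y \<in> G \<Longrightarrow> b \<le> emeasure (sample_law \<nu> n (f_par \<nu> f0 M \<Lambda> y)) A"
  shows "2 * t * (b * emeasure (power_law P M) G)
    \<le> exp_moment_product \<nu> 1 n f0 M \<Lambda> P + t\<^sup>2 * emeasure (sample_law \<nu> n f0) A"
proof -
  define PM where "PM = power_law P M"
  define S where "S = sample_law \<nu> n f0"
  define N where "N = density \<nu> (\<lambda>x. ennreal (f0 x))"
  define g where "g y x = ennreal (f_par \<nu> f0 M \<Lambda> y x / f0 x)" for y x
  \<comment> \<open>The indicator discards the parameters outside \<open>G\<close>, for which
    \<open>f_par\<close> may be negative somewhere.\<close>
  define k where "k y x = indicator G y * (\<Prod>i<n. g y (x i))" for y :: "nat \<Rightarrow> real" and x :: "nat \<Rightarrow> 'a"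
  \<comment> \<open>\<open>L\<close> is the density with respect to \<open>S\<close> of the mixture
    over \<open>G\<close> of the sample laws, a measure of total mass
    \<open>emeasure PM G\<close>.\<close>
  define L where "L x = (\<integral>\<^sup>+y. k y x \<partial>PM)" for x
  have f0: "f0 \<in> prob_densities \<nu>" using pf by (simp add: parameterized_family_def admissible_densities_def)
  have pP: "prob_space P" and sP: "sets P = sets (restrict_space borel Y)"
    using pf by (auto simp: parameterized_family_def)
  have pN: "prob_space N" unfolding N_def by (rule prob_space_density_of_prob_densities[OF f0])
  interpret PM: prob_space PM unfolding PM_def power_law_def by (intro prob_space_PiM pP)
  interpret S: prob_space S
    unfolding S_def sample_law_def by (intro prob_space_PiM prob_space_density_of_prob_densities[OF f0])
  interpret PS: pair_sigma_finite PM S ..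
  interpret N: product_sigma_finite "\<lambda>_::nat. N" by (rule product_sigma_finite_const_prob[OF pN])
  have setsS: "sets S = sets (\<Pi>\<^sub>M i\<in>{..<n}. \<nu>)"
    unfolding S_def sample_law_def by (intro sets_PiM_cong) auto
  have [measurable]: "f0 \<in> borel_measurable \<nu>" using f0 by (simp add: prob_densities_def)
  have idP[measurable]: "(\<lambda>x. x) \<in> borel_measurable P"
    unfolding measurable_cong_sets[OF sP refl] by (rule measurable_restrict_space1) auto
  have \<Lambda>m[measurable]: "m \<in> {1..M} \<Longrightarrow> \<Lambda> m \<in> borel_measurable \<nu>" for m
    using pf by (simp add: parameterized_family_def)
  have comp_y: "(\<lambda>q. fst q m) \<in> borel_measurable (PM \<Otimes>\<^sub>M S)" if m: "m \<in> {1..M}" for m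
  proof -
    have c: "(\<lambda>y. y m) \<in> measurable PM P"
      unfolding PM_def power_law_def using m by (rule measurable_component_singleton)
    show ?thesis by (rule measurable_compose[OF measurable_compose[OF measurable_fst c] idP])
  qed
  have comp_x: "(\<lambda>q. snd q i) \<in> measurable (PM \<Otimes>\<^sub>M S) \<nu>" if i: "i < n" for i
  proof -
    have c: "(\<lambda>x. x i) \<in> measurable S \<nu>"
      unfolding measurable_cong_sets[OF setsS refl] using i by (intro measurable_component_singleton) auto
    show ?thesis by (rule measurable_compose[OF measurable_snd c])
  qed
  have GM[measurable]: "G \<in> sets PM" using G(1) by (simp add: PM_def)
  have AS[measurable]: "A \<in> sets S" using A by (simp add: setsS)
  \<comment> \<open>The three exchanges of integrals below rest on this joint measurability in
    parameter and sample.\<close>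
  have km: "(\<lambda>q. k (fst q) (snd q)) \<in> borel_measurable (PM \<Otimes>\<^sub>M S)"
    unfolding k_def g_def f_par_def rho_def
    by (intro borel_measurable_times_ennreal borel_measurable_prod_ennreal measurable_compose[OF _ measurable_ennreal]
        borel_measurable_divide borel_measurable_add borel_measurable_times borel_measurable_diff
        borel_measurable_sum borel_measurable_const comp_y measurable_compose[OF comp_x \<Lambda>m]
        measurable_compose[OF comp_x \<open>f0 \<in> borel_measurable \<nu>\<close>]
        measurable_compose[OF measurable_fst borel_measurable_indicator[OF GM]]) auto
  have ky: "(\<lambda>y. k y x) \<in> borel_measurable PM" if "x \<in> space S" for x
    using measurable_compose[OF measurable_Pair[OF measurable_ident measurable_const[OF that]] km] by simp
  have kx[measurable]: "k y \<in> borel_measurable S" if "y \<in> space PM" for y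
    using measurable_compose[OF measurable_Pair[OF measurable_const[OF that] measurable_ident] km] by simp
  have Lm[measurable]: "L \<in> borel_measurable S"
    unfolding L_def using measurable_pair_swap[OF km]
    by (intro PM.borel_measurable_nn_integral) (simp add: case_prod_beta')
  have LmP: "(\<lambda>q. L (snd q)) \<in> borel_measurable (PM \<Otimes>\<^sub>M S)"
    by (rule measurable_compose[OF measurable_snd Lm])

  \<comment> \<open>Each sample law in the mixture gives \<open>A\<close> at least the mass
    \<open>b\<close>; averaging over \<open>G\<close> and exchanging the integrals transfers this to
    \<open>L\<close>.\<close>
  have mass: "b * emeasure PM G \<le> (\<integral>\<^sup>+x. L x * indicator A x \<partial>S)"
  proof -
    have "b * emeasure PM G = (\<integral>\<^sup>+y. b * indicator G y \<partial>PM)"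
      by (simp add: nn_integral_cmult_indicator)
    also have "\<dots> \<le> (\<integral>\<^sup>+y. \<integral>\<^sup>+x. k y x * indicator A x \<partial>S \<partial>PM)"
    proof (intro nn_integral_mono)
      fix y assume "y \<in> space PM"
      show "b * indicator G y \<le> (\<integral>\<^sup>+x. k y x * indicator A x \<partial>S)"
      proof (cases "y \<in> G")
        case True
        note fy = G(3)[OF True]
        have [measurable]: "f_par \<nu> f0 M \<Lambda> y \<in> borel_measurable \<nu>" using fy by (simp add: prob_densities_def)
        have ac: "f_par \<nu> f0 M \<Lambda> y x = 0" if x: "x \<in> space \<nu>" "f0 x = 0" for x
          using perturbation_zero_off_base[OF ds pb x] x by (simp add: f_par_def)
        have gm: "(\<lambda>x. \<Prod>i<n. g y (x i)) \<in> borel_measurable S"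
          unfolding measurable_cong_sets[OF setsS refl] g_def by measurable
        have sl: "sample_law \<nu> n (f_par \<nu> f0 M \<Lambda> y) = density S (\<lambda>x. \<Prod>i<n. g y (x i))"
          unfolding S_def g_def by (rule sample_law_ratio[OF fy f0 ac])
        have "emeasure (sample_law \<nu> n (f_par \<nu> f0 M \<Lambda> y)) A = (\<integral>\<^sup>+x. (\<Prod>i<n. g y (x i)) * indicator A x \<partial>S)"
          unfolding sl using gm AS by (subst emeasure_density) (auto simp: g_def)
        then show ?thesis using b[OF True] True by (simp add: k_def)
      qed simp
    qed
    also have "\<dots> = (\<integral>\<^sup>+x. \<integral>\<^sup>+y. k y x * indicator A x \<partial>PM \<partial>S)"
      by (rule PS.Fubini'[symmetric])
        (simp add: case_prod_beta' borel_measurable_times_ennreal km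
          measurable_compose[OF measurable_snd borel_measurable_indicator[OF AS]])
    also have "\<dots> = (\<integral>\<^sup>+x. L x * indicator A x \<partial>S)"
      by (intro nn_integral_cong) (simp add: L_def nn_integral_multc ky)
    finally show ?thesis .
  qed

  have SN: "S = (\<Pi>\<^sub>M i\<in>{..<n}. N)" by (simp add: S_def sample_law_def N_def)
  \<comment> \<open>The observations are independent under \<open>S\<close>, so the integral is the
    n-th power of the one-observation integral.\<close>
  have pair: "(\<integral>\<^sup>+x. k y x * k z x \<partial>S)
      \<le> ennreal (exp (real n * (\<Sum>m=1..M. y m * z m * S_par \<nu> f0 \<Lambda> m)))" for y z
  proof (cases "y \<in> G \<and> z \<in> G")
    case True
    then have yz: "y \<in> G" "z \<in> G" by auto
    have [measurable]: "f_par \<nu> f0 M \<Lambda> y \<in> borel_measurable \<nu>" "f_par \<nu> f0 M \<Lambda> z \<in> borel_measurable \<nu>"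
      using G(3) yz by (simp_all add: prob_densities_def)
    have "(\<integral>\<^sup>+x. k y x * k z x \<partial>S) = (\<integral>\<^sup>+x. (\<Prod>i<n. g y (x i) * g z (x i)) \<partial>S)"
      using yz by (simp add: k_def prod.distrib)
    also have "\<dots> = (\<Prod>i<n. \<integral>\<^sup>+x. g y x * g z x \<partial>N)"
      unfolding SN by (rule N.product_nn_integral_prod) (simp_all add: g_def N_def)
    also have "\<dots> \<le> ennreal (exp (real n * (\<Sum>m=1..M. y m * z m * S_par \<nu> f0 \<Lambda> m)))"
      using likelihood_pair_integral_le_exp[OF pf ds pb cases _ G(3) _ G(3), of y z n] yz G(2)
      by (auto simp: g_def N_def)
    finally show ?thesis .
  next
    case False
    then have "k y x * k z x = 0" for x by (auto simp: k_def)
    then show ?thesis by (simp only: nn_integral_const mult_zero_left zero_le)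
  qed

  \<comment> \<open>The square of the mixture is a double integral over two independent parameters
    \<open>y\<close> and \<open>z\<close>; the sample is integrated out first, then the exponential
    bound averaged over both.\<close>
  have second: "(\<integral>\<^sup>+x. L x * L x \<partial>S) \<le> exp_moment_product \<nu> 1 n f0 M \<Lambda> P"
  proof -
    have "(\<integral>\<^sup>+x. L x * L x \<partial>S) = (\<integral>\<^sup>+x. \<integral>\<^sup>+y. k y x * L x \<partial>PM \<partial>S)"
      by (intro nn_integral_cong) (simp add: nn_integral_multc ky, simp add: L_def)
    also have "\<dots> = (\<integral>\<^sup>+y. \<integral>\<^sup>+x. k y x * L x \<partial>S \<partial>PM)"
      by (rule PS.Fubini') (simp add: case_prod_beta' borel_measurable_times_ennreal km LmP)
    also have "\<dots> = (\<integral>\<^sup>+y. \<integral>\<^sup>+x. \<integral>\<^sup>+z. k y x * k z x \<partial>PM \<partial>S \<partial>PM)"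
      by (intro nn_integral_cong) (simp add: L_def nn_integral_cmult ky)
    also have "\<dots> = (\<integral>\<^sup>+y. \<integral>\<^sup>+z. \<integral>\<^sup>+x. k y x * k z x \<partial>S \<partial>PM \<partial>PM)"
    proof (intro nn_integral_cong PS.Fubini')
      fix y assume "y \<in> space PM"
      then have "(\<lambda>q. k y (snd q)) \<in> borel_measurable (PM \<Otimes>\<^sub>M S)"
        by (intro measurable_compose[OF measurable_snd kx])
      then show "(\<lambda>(z, x). k y x * k z x) \<in> borel_measurable (PM \<Otimes>\<^sub>M S)"
        by (simp add: case_prod_beta' borel_measurable_times_ennreal km)
    qed
    also have "\<dots> \<le> (\<integral>\<^sup>+y. \<integral>\<^sup>+z. ennreal (exp (real n * (\<Sum>m=1..M. y m * z m * S_par \<nu> f0 \<Lambda> m))) \<partial>PM \<partial>PM)"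
      by (intro nn_integral_mono pair)
    also have "\<dots> = exp_moment_product \<nu> 1 n f0 M \<Lambda> P"
      unfolding PM_def by (rule exp_moment_product_eq[OF pf])
    finally show ?thesis .
  qed

  have "2 * t * (b * emeasure PM G) \<le> 2 * t * (\<integral>\<^sup>+x. L x * indicator A x \<partial>S)"
    by (intro mult_left_mono mass) simp
  also have "\<dots> = (\<integral>\<^sup>+x. 2 * t * (L x * indicator A x) \<partial>S)"
    by (simp add: nn_integral_cmult)
  also have "\<dots> \<le> (\<integral>\<^sup>+x. L x * L x + t\<^sup>2 * indicator A x \<partial>S)"
    using ennreal_sum_squares_bound by (intro nn_integral_mono) (simp add: indicator_def)
  also have "\<dots> = (\<integral>\<^sup>+x. L x * L x \<partial>S) + t\<^sup>2 * emeasure S A"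
    by (simp add: nn_integral_add nn_integral_cmult)
  also have "\<dots> \<le> exp_moment_product \<nu> 1 n f0 M \<Lambda> P + t\<^sup>2 * emeasure S A"
    by (intro add_right_mono second)
  finally show ?thesis by (simp add: PM_def S_def)
qed

section \<open>Trade-off between two risks at a fixed sample size\<close>

lemma ennreal_sqrt_le_iff:
  assumes "0 \<le> r"
  shows "ennreal_sqrt a \<le> ennreal r \<longleftrightarrow> a \<le> ennreal (r\<^sup>2)"
proof (cases a)
  case (real x)
  then show ?thesis using assms by (simp add: ennreal_sqrt_def real_sqrt_le_iff')
next
  case top
  then show ?thesis by (simp add: ennreal_sqrt_def top_unique)
qed

text \<open>The squared error is at least \<open>s\<^sup>2\<close> on \<open>A\<close>, while its
  mean is at most \<open>r\<^sup>2\<close> because the risk is a supremum over a class containing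
  \<open>f\<close>; Markov's inequality does the rest.\<close>

lemma risk_chebyshev:
  assumes T: "T \<in> estimators \<nu> n" and f: "f \<in> \<F>"
    and r: "risk \<nu> \<Phi> n T \<F> \<le> ennreal r" "0 \<le> r" and s: "0 \<le> s"
    and A: "A \<in> sets (\<Pi>\<^sub>M i\<in>{..<n}. \<nu>)" "\<And>x. x \<in> A \<Longrightarrow> s \<le> \<bar>T x - real_of_ereal (\<Phi> f)\<bar>"
  shows "ennreal (s\<^sup>2) * emeasure (sample_law \<nu> n f) A \<le> ennreal (r\<^sup>2)"
proof -
  have setsS: "sets (sample_law \<nu> n f) = sets (\<Pi>\<^sub>M i\<in>{..<n}. \<nu>)"
    unfolding sample_law_def by (intro sets_PiM_cong) auto
  have "ennreal (s\<^sup>2) * emeasure (sample_law \<nu> n f) A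
      = (\<integral>\<^sup>+x. ennreal (s\<^sup>2) * indicator A x \<partial>sample_law \<nu> n f)"
    using A(1) by (simp add: setsS nn_integral_cmult_indicator)
  also have "\<dots> \<le> (\<integral>\<^sup>+x. ennreal ((T x - real_of_ereal (\<Phi> f))\<^sup>2) \<partial>sample_law \<nu> n f)"
    using A(2) s by (intro nn_integral_mono) (auto simp: indicator_def abs_le_square_iff[symmetric] intro!: ennreal_leI)
  also have "\<dots> \<le> ennreal (r\<^sup>2)"
  proof -
    have "ennreal_sqrt (\<integral>\<^sup>+x. ennreal ((T x - real_of_ereal (\<Phi> f))\<^sup>2) \<partial>sample_law \<nu> n f) \<le> risk \<nu> \<Phi> n T \<F>"
      unfolding risk_def by (rule SUP_upper[OF f])
    then show ?thesis using r by (simp add: ennreal_sqrt_le_iff[symmetric])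
  qed
  finally show ?thesis .
qed

text \<open>An estimator precise on \<G> is far from \<open>\<Phi> f0\<close> under most
  perturbations. The mixture bound forces this event to keep probability at least 1 / (2 v) under
  \<open>f0\<close>, and Chebyshev's inequality converts that into a lower bound on the risk over
  \<F>.\<close>

lemma constrained_risk_inequality:
  assumes pf: "parameterized_family \<nu> \<Phi> f0 M \<Lambda> Y P"
    and ds: "disjoint_supports \<nu> M \<Lambda> D" and pb: "positive_base \<F> f0 M D"
    and cases: "centered_case \<nu> f0 M \<Lambda> Y \<or> nonneg_case \<nu> M \<Lambda> Y"
    and mc: "mostly_in_class \<nu> \<G> f0 M \<Lambda> Y P" and ms: "mostly_separated \<nu> \<Phi> s f0 M \<Lambda> Y P"
    and GG: "\<G> \<subseteq> admissible_densities \<nu> \<Phi>"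
    and T: "T \<in> estimators \<nu> n" and s: "0 < s"
    and r: "risk \<nu> \<Phi> n T \<G> \<le> ennreal r" "0 \<le> r" "r \<le> s / 10"
    and r': "risk \<nu> \<Phi> n T \<F> \<le> ennreal r'" "0 \<le> r'"
    and v: "exp_moment_product \<nu> 1 n f0 M \<Lambda> P \<le> ennreal v" "0 < v"
  shows "s\<^sup>2 \<le> 2 * v * r'\<^sup>2"
proof -
  let ?f = "f_par \<nu> f0 M \<Lambda>"
  define PM where "PM = power_law P M"
  define G1 where "G1 = {y\<in>cube Y M. ?f y \<in> \<G>}"
  define G2 where "G2 = {y\<in>cube Y M. \<bar>\<Phi> (?f y) - \<Phi> f0\<bar> > ereal (2 * s)}"
  define A where "A = {x\<in>space (\<Pi>\<^sub>M i\<in>{..<n}. \<nu>). s < \<bar>T x - real_of_ereal (\<Phi> f0)\<bar>}"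
  define B where "B = space (\<Pi>\<^sub>M i\<in>{..<n}. \<nu>) - A"
  have f0: "f0 \<in> prob_densities \<nu>" "f0 \<in> admissible_densities \<nu> \<Phi>"
    using pf by (simp_all add: parameterized_family_def admissible_densities_def)
  have pP: "prob_space P" using pf by (simp add: parameterized_family_def)
  interpret PM: prob_space PM unfolding PM_def power_law_def by (intro prob_space_PiM pP)
  have prS: "prob_space (sample_law \<nu> n f)" if "f \<in> prob_densities \<nu>" for f
    unfolding sample_law_def by (intro prob_space_PiM prob_space_density_of_prob_densities that)
  interpret S: prob_space "sample_law \<nu> n f0" by (rule prS[OF f0(1)])
  have setsS: "sets (sample_law \<nu> n f) = sets (\<Pi>\<^sub>M i\<in>{..<n}. \<nu>)" for f
    unfolding sample_law_def by (intro sets_PiM_cong) auto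
  have [measurable]: "T \<in> borel_measurable (\<Pi>\<^sub>M i\<in>{..<n}. \<nu>)" using T by (simp add: estimators_def)
  have As: "A \<in> sets (\<Pi>\<^sub>M i\<in>{..<n}. \<nu>)" unfolding A_def by measurable
  then have Bs: "B \<in> sets (\<Pi>\<^sub>M i\<in>{..<n}. \<nu>)" unfolding B_def by auto

  have m1: "measure PM G1 \<ge> 230/231" and m2: "measure PM G2 \<ge> 230/231"
    using mc ms by (simp_all add: mostly_in_class_def mostly_separated_def G1_def G2_def PM_def)
  \<comment> \<open>A non-measurable set would have \<open>measure\<close> 0, against the lower
    bounds.\<close>
  then have G1s: "G1 \<in> sets PM" and G2s: "G2 \<in> sets PM"
    using measure_notin_sets[of G1 PM] measure_notin_sets[of G2 PM] by force+
  \<comment> \<open>Each of the two requirements fails with probability at most 1/231, so both hold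
    with probability at least 229/231.\<close>
  have "measure PM (G1 - G2) \<le> measure PM (space PM - G2)"
    using G1s G2s sets.sets_into_space by (intro PM.finite_measure_mono) auto
  also have "\<dots> = 1 - measure PM G2" using G2s by (rule PM.prob_compl)
  finally have "measure PM (G1 \<inter> G2) \<ge> 229/231"
    using PM.finite_measure_Diff'[OF G1s G2s] m1 m2 by linarith
  then have mG: "ennreal (229/231) \<le> emeasure PM (G1 \<inter> G2)"
    by (simp add: PM.emeasure_eq_measure)

  \<comment> \<open>On \<open>B\<close> the estimator is within \<open>s\<close> of
    \<open>\<Phi> f0\<close>, hence more than \<open>s\<close> away from
    \<open>\<Phi> (?f y)\<close>. As r \<le> s / 10, this has probability at most 1/100.\<close>
  have b: "ennreal (99/100) \<le> emeasure (sample_law \<nu> n (?f y)) A" if y: "y \<in> G1 \<inter> G2" for y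
  proof -
    have fy: "?f y \<in> \<G>" "\<bar>\<Phi> (?f y) - \<Phi> f0\<bar> > ereal (2 * s)" using y by (auto simp: G1_def G2_def)
    then have fya: "?f y \<in> prob_densities \<nu>" "\<bar>\<Phi> (?f y)\<bar> < \<infinity>"
      using GG by (auto simp: admissible_densities_def)
    interpret Q: prob_space "sample_law \<nu> n (?f y)" by (rule prS[OF fya(1)])
    obtain a where a: "\<Phi> (?f y) = ereal a" using fya(2) by (cases "\<Phi> (?f y)") auto
    obtain a0 where a0: "\<Phi> f0 = ereal a0" using f0(2) by (cases "\<Phi> f0") (auto simp: admissible_densities_def)
    have sep: "2 * s < \<bar>a - a0\<bar>" using fy(2) by (simp add: a a0)
    have "ennreal (s\<^sup>2) * emeasure (sample_law \<nu> n (?f y)) B \<le> ennreal (r\<^sup>2)"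
    proof (rule risk_chebyshev[OF T fy(1) r(1,2) _ Bs])
      fix x assume "x \<in> B"
      then have "\<bar>T x - a0\<bar> \<le> s" by (auto simp: A_def B_def a0)
      then show "s \<le> \<bar>T x - real_of_ereal (\<Phi> (?f y))\<bar>" using sep by (simp add: a)
    qed (use s in simp)
    also have "\<dots> \<le> ennreal (s\<^sup>2 * (1/100))"
      using power_mono[OF r(3,2), of 2] by (intro ennreal_leI) (simp add: power_divide)
    finally have "s\<^sup>2 * Q.prob B \<le> s\<^sup>2 * (1/100)"
      by (simp add: Q.emeasure_eq_measure flip: ennreal_mult)
    then have "Q.prob B \<le> 1/100" using s by (simp add: mult_le_cancel_left_pos)
    moreover have "Q.prob B = 1 - Q.prob A"
      using Q.prob_compl[of A] As sets_eq_imp_space_eq[OF setsS] by (simp add: B_def setsS)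
    ultimately show ?thesis by (simp add: Q.emeasure_eq_measure)
  qed

  \<comment> \<open>The choice \<open>t = v\<close> balances the two terms on the right when
    \<open>A\<close> has probability of order 1 / v under \<open>f0\<close>.\<close>
  have "2 * ennreal v * (ennreal (99/100) * emeasure PM (G1 \<inter> G2))
     \<le> exp_moment_product \<nu> 1 n f0 M \<Lambda> P + (ennreal v)\<^sup>2 * emeasure (sample_law \<nu> n f0) A"
    unfolding PM_def
  proof (rule mixture_testing_bound[OF pf ds pb cases])
    show "?f y \<in> prob_densities \<nu>" if "y \<in> G1 \<inter> G2" for y
      using that GG by (auto simp: G1_def admissible_densities_def)
  qed (use G1s G2s b As in \<open>auto simp: PM_def G1_def\<close>)
  moreover have "2 * ennreal v * (ennreal (99/100) * ennreal (229/231))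
    \<le> 2 * ennreal v * (ennreal (99/100) * emeasure PM (G1 \<inter> G2))"
    by (intro mult_left_mono mG) auto
  moreover have "exp_moment_product \<nu> 1 n f0 M \<Lambda> P + (ennreal v)\<^sup>2 * emeasure (sample_law \<nu> n f0) A
    \<le> ennreal v + (ennreal v)\<^sup>2 * emeasure (sample_law \<nu> n f0) A"
    by (intro add_right_mono v)
  ultimately have "2 * ennreal v * (ennreal (99/100) * ennreal (229/231))
    \<le> ennreal v + (ennreal v)\<^sup>2 * emeasure (sample_law \<nu> n f0) A"
    by (meson order_trans)
  also have "2 * ennreal v * (ennreal (99/100) * ennreal (229/231)) = ennreal (2 * v * (99/100 * (229/231)))"
    using v(2) by (simp only: ennreal_mult ennreal_numeral zero_le_numeral mult_nonneg_nonneg less_imp_le) 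
  also have "ennreal v + (ennreal v)\<^sup>2 * emeasure (sample_law \<nu> n f0) A = ennreal (v + v\<^sup>2 * S.prob A)"
    using v(2) by (simp add: S.emeasure_eq_measure ennreal_mult ennreal_power)
  finally have "2 * v * (99/100 * (229/231)) \<le> v + v\<^sup>2 * S.prob A"
    using v(2) by (subst (asm) ennreal_le_iff) auto
  \<comment> \<open>The constant 2 * (99/100) * (229/231) - 1 is about 0.96, well above 1/2.\<close>
  then have "v * (1/2) \<le> v * (v * S.prob A)"
    using v(2) by (simp add: power2_eq_square algebra_simps)
  then have half: "1/2 \<le> v * S.prob A" using v(2) by (simp only: mult_le_cancel_left_pos)
  have "ennreal (s\<^sup>2) * emeasure (sample_law \<nu> n f0) A \<le> ennreal (r'\<^sup>2)"
    using pb s by (intro risk_chebyshev[OF T _ r' _ As]) (auto simp: positive_base_def A_def)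
  then have "s\<^sup>2 * S.prob A \<le> r'\<^sup>2"
    by (simp add: S.emeasure_eq_measure flip: ennreal_mult)
  then have "v * (s\<^sup>2 * S.prob A) \<le> v * r'\<^sup>2" using v(2) by (simp add: mult_left_mono)
  moreover have "s\<^sup>2 * (1/2) \<le> s\<^sup>2 * (v * S.prob A)" using half by (intro mult_left_mono) auto
  ultimately show ?thesis by (simp add: algebra_simps)
qed

section \<open>From limits of risk quotients to eventual bounds\<close>

text \<open>Any number above the limit superior is an eventual bound; adding 1 keeps the constant
  positive even when the limit superior is 0.\<close>

lemma limsup_quotient_bound:
  fixes R :: "nat \<Rightarrow> ennreal"
  assumes \<mu>: "\<And>n. 0 < \<mu> n" and fin: "limsup (\<lambda>n. R n / ennreal (\<mu> n)) < \<infinity>"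
  obtains C where "0 < C" "\<forall>\<^sub>F n in sequentially. R n \<le> ennreal (C * \<mu> n)"
proof -
  obtain x where x: "0 \<le> x" "limsup (\<lambda>n. R n / ennreal (\<mu> n)) = ennreal x"
    using fin by (cases "limsup (\<lambda>n. R n / ennreal (\<mu> n))") auto
  then have "limsup (\<lambda>n. R n / ennreal (\<mu> n)) < ennreal (x + 1)" by (simp add: ennreal_lessI)
  then have "\<forall>\<^sub>F n in sequentially. R n / ennreal (\<mu> n) < ennreal (x + 1)" by (rule Limsup_lessD)
  then have "\<forall>\<^sub>F n in sequentially. R n \<le> ennreal ((x + 1) * \<mu> n)"
  proof eventually_elim
    case (elim n)
    have "R n = (R n / ennreal (\<mu> n)) * ennreal (\<mu> n)"
      using \<mu>[of n] by (simp add: ennreal_divide_times mult_divide_eq_ennreal)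
    also have "\<dots> \<le> ennreal (x + 1) * ennreal (\<mu> n)" using elim by (intro mult_right_mono) auto
    finally show ?case using x \<mu>[of n] by (simp add: ennreal_mult)
  qed
  then show thesis using x by (intro that[of "x + 1"]) auto
qed

text \<open>The minimax risk is eventually at least a constant times \<phi>, and it is at most the
  risk of \<open>T\<close>, which is eventually at most a constant times \<mu>.\<close>

lemma minimax_rate_le_admissible:
  assumes rate: "minimax_rate \<nu> \<Phi> \<F> \<phi>" and T: "\<And>n. T n \<in> estimators \<nu> n"
    and \<mu>: "\<And>n. 0 < \<mu> n" and fin: "limsup (\<lambda>n. risk \<nu> \<Phi> n (T n) \<F> / ennreal (\<mu> n)) < \<infinity>"
  obtains K where "0 < K" "\<forall>\<^sub>F n in sequentially. \<phi> n \<le> K * \<mu> n"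
proof -
  obtain C where C: "0 < C" "\<forall>\<^sub>F n in sequentially. risk \<nu> \<Phi> n (T n) \<F> \<le> ennreal (C * \<mu> n)"
    using limsup_quotient_bound[OF \<mu> fin] .
  have \<phi>: "0 < \<phi> n" for n using rate by (simp add: minimax_rate_def)
  have "0 < liminf (\<lambda>n. minimax_risk \<nu> \<Phi> n \<F> / ennreal (\<phi> n))" using rate by (simp add: minimax_rate_def)
  \<comment> \<open>A value strictly below the limit inferior is finite even if the limit inferior
    is not.\<close>
  from dense[OF this] obtain d where d: "0 < d" "d < liminf (\<lambda>n. minimax_risk \<nu> \<Phi> n \<F> / ennreal (\<phi> n))" by blast
  have "d < top" by (rule less_le_trans[OF d(2) top_greatest])
  then obtain e where e: "d = ennreal e" "0 < e" using d(1) by (cases d) auto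
  have "\<forall>\<^sub>F n in sequentially. ennreal e < minimax_risk \<nu> \<Phi> n \<F> / ennreal (\<phi> n)"
    using d(2) unfolding e by (rule less_LiminfD)
  then have "\<forall>\<^sub>F n in sequentially. \<phi> n \<le> C / e * \<mu> n"
    using C(2)
  proof eventually_elim
    case (elim n)
    have "ennreal (e * \<phi> n) = ennreal e * ennreal (\<phi> n)" using e \<phi>[of n] by (simp add: ennreal_mult)
    also have "\<dots> \<le> minimax_risk \<nu> \<Phi> n \<F> / ennreal (\<phi> n) * ennreal (\<phi> n)" using elim by (intro mult_right_mono) auto
    also have "\<dots> = minimax_risk \<nu> \<Phi> n \<F>"
      using \<phi>[of n] by (simp add: ennreal_divide_times mult_divide_eq_ennreal)
    also have "\<dots> \<le> risk \<nu> \<Phi> n (T n) \<F>" unfolding minimax_risk_def by (rule INF_lower[OF T])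
    also have "\<dots> \<le> ennreal (C * \<mu> n)" using elim by simp
    finally have "e * \<phi> n \<le> C * \<mu> n" using C(1) \<mu>[of n] by (simp add: ennreal_le_iff)
    then show ?case using e(2) by (simp add: field_simps)
  qed
  then show thesis using C(1) e(2) by (intro that[of "C / e"]) auto
qed

text \<open>The constrained risk inequality is applied with \<open>v\<close> an arbitrarily small
  multiple of \<open>(\<alpha> n)\<^sup>2\<close>, which the moment condition permits for all large
  \<open>n\<close>.\<close>

lemma lower_bound_ratio:
  assumes lb: "lower_bound_conditions \<nu> \<Phi> \<F> \<G> \<phi> \<psi> f0 M \<Lambda> Y P"
    and GG: "\<G> \<subseteq> admissible_densities \<nu> \<Phi>" and T: "\<And>n. T n \<in> estimators \<nu> n"
    and pos: "\<And>n. 0 < \<psi> n" "\<And>n. 0 < \<mu> n" "\<And>n. 0 < \<mu>' n" "\<And>n. 0 < \<alpha> n"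
    and moment: "(\<lambda>n. ennreal (1 / (\<alpha> n)\<^sup>2) * exp_moment_product \<nu> 1 n (f0 n) (M n) (\<Lambda> n) (P n)) \<longlonglongrightarrow> 0"
    and finG: "limsup (\<lambda>n. risk \<nu> \<Phi> n (T n) \<G> / ennreal (\<mu> n)) < \<infinity>"
    and finF: "limsup (\<lambda>n. risk \<nu> \<Phi> n (T n) \<F> / ennreal (\<mu>' n)) < \<infinity>"
    and small: "\<mu> \<in> o(\<psi>)"
  shows "(\<lambda>n. \<psi> n / (\<mu>' n * \<alpha> n)) \<longlonglongrightarrow> 0"
proof (rule order_tendstoI)
  fix a :: real assume "a < 0"
  then show "\<forall>\<^sub>F n in sequentially. a < \<psi> n / (\<mu>' n * \<alpha> n)"
    by (intro always_eventually allI) (meson divide_nonneg_nonneg less_imp_le less_le_trans mult_nonneg_nonneg pos)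
next
  fix a :: real assume a: "0 < a"
  obtain C where C: "0 < C" "\<forall>\<^sub>F n in sequentially. risk \<nu> \<Phi> n (T n) \<G> \<le> ennreal (C * \<mu> n)"
    using limsup_quotient_bound[OF pos(2) finG] .
  obtain C' where C': "0 < C'" "\<forall>\<^sub>F n in sequentially. risk \<nu> \<Phi> n (T n) \<F> \<le> ennreal (C' * \<mu>' n)"
    using limsup_quotient_bound[OF pos(3) finF] .
  \<comment> \<open>With \<open>v = e * (\<alpha> n)\<^sup>2\<close> the bound 2 v r'^2 becomes half
    the square of \<open>a * (\<mu>' n * \<alpha> n)\<close>; the half makes the final inequality
    strict.\<close>
  define e where "e = a\<^sup>2 / (4 * C'\<^sup>2)"
  have e: "0 < e" using a C' by (simp add: e_def)
  \<comment> \<open>The factor 1 / (10 C) brings the risk over \<G> below a tenth of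
    \<open>\<psi> n\<close>, as the constrained risk inequality requires.\<close>
  have "\<forall>\<^sub>F n in sequentially. norm (\<mu> n) \<le> 1 / (10 * C) * norm (\<psi> n)"
    using landau_o.smallD[OF small, of "1 / (10 * C)"] C(1) by simp
  moreover have "\<forall>\<^sub>F n in sequentially.
      ennreal (1 / (\<alpha> n)\<^sup>2) * exp_moment_product \<nu> 1 n (f0 n) (M n) (\<Lambda> n) (P n) < ennreal e"
    using order_tendstoD(2)[OF moment] e by simp
  moreover have "\<forall>\<^sub>F n in sequentially. mostly_separated \<nu> \<Phi> (\<psi> n) (f0 n) (M n) (\<Lambda> n) (Y n) (P n)"
    using lb by (simp add: lower_bound_conditions_def)
  ultimately show "\<forall>\<^sub>F n in sequentially. \<psi> n / (\<mu>' n * \<alpha> n) < a"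
    using C(2) C'(2)
  proof eventually_elim
    case (elim n)
    obtain D where D: "disjoint_supports \<nu> (M n) (\<Lambda> n) D" "positive_base \<F> (f0 n) (M n) D"
      using lb unfolding lower_bound_conditions_def by blast
    have pf: "parameterized_family \<nu> \<Phi> (f0 n) (M n) (\<Lambda> n) (Y n) (P n)"
      and mc: "mostly_in_class \<nu> \<G> (f0 n) (M n) (\<Lambda> n) (Y n) (P n)"
      and cases: "centered_case \<nu> (f0 n) (M n) (\<Lambda> n) (Y n) \<or> nonneg_case \<nu> (M n) (\<Lambda> n) (Y n)"
      using lb by (auto simp: lower_bound_conditions_def)
    let ?E = "exp_moment_product \<nu> 1 n (f0 n) (M n) (\<Lambda> n) (P n)"
    have "?E = ennreal ((\<alpha> n)\<^sup>2) * (ennreal (1 / (\<alpha> n)\<^sup>2) * ?E)"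
      using pos(4)[of n] by (simp add: mult.assoc[symmetric] flip: ennreal_mult)
    also have "\<dots> \<le> ennreal ((\<alpha> n)\<^sup>2) * ennreal e" using elim by (intro mult_left_mono) auto
    also have "\<dots> = ennreal (e * (\<alpha> n)\<^sup>2)" using e by (simp add: mult.commute flip: ennreal_mult)
    finally have E: "?E \<le> ennreal (e * (\<alpha> n)\<^sup>2)" .
    have "C * \<mu> n \<le> \<psi> n / 10" using elim(1) C(1) pos(1,2)[of n] by (simp add: field_simps)
    moreover have "0 \<le> C * \<mu> n" "0 \<le> C' * \<mu>' n" using C(1) C'(1) pos(2,3)[of n] by simp_all
    moreover have "0 < e * (\<alpha> n)\<^sup>2" using e pos(4)[of n] by simp
    ultimately have "(\<psi> n)\<^sup>2 \<le> 2 * (e * (\<alpha> n)\<^sup>2) * (C' * \<mu>' n)\<^sup>2"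
      using constrained_risk_inequality[OF pf D cases mc elim(3) GG T pos(1) elim(4) _ _ elim(5) _ E] by blast
    also have "\<dots> = (a * (\<mu>' n * \<alpha> n))\<^sup>2 / 2"
      using C'(1) by (simp add: e_def power_mult_distrib field_simps)
    also have "\<dots> < (a * (\<mu>' n * \<alpha> n))\<^sup>2" using a pos(3,4)[of n] by simp
    finally have sq: "(\<psi> n)\<^sup>2 < (a * (\<mu>' n * \<alpha> n))\<^sup>2" .
    have prod: "0 < \<mu>' n * \<alpha> n" using pos(3,4)[of n] by simp
    then have "\<psi> n < a * (\<mu>' n * \<alpha> n)"
      using a by (intro power2_less_imp_less[OF sq] mult_nonneg_nonneg less_imp_le)
    then show ?case using prod by (simp only: pos_divide_less_eq)
  qed
qed

section \<open>Comparison of orders\<close>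

text \<open>The other two alternatives of \<open>comparable_orders\<close> bound the quotient of
  \<psi> by \<mu> eventually, which contradicts its infinite limit superior.\<close>

lemma Theta_minus_smallo:
  assumes \<psi>: "normalization_family \<Theta>\<^sub>r \<psi>" and \<mu>: "normalization_family \<Theta>\<^sub>r \<mu>"
    and \<theta>: "\<theta> \<in> Theta_minus \<Theta>\<^sub>r \<psi> \<mu>"
  shows "\<mu> \<theta> \<in> o(\<psi> \<theta>)"
proof (rule ccontr)
  assume "\<mu> \<theta> \<notin> o(\<psi> \<theta>)"
  with \<theta> have "\<psi> \<theta> \<in> O(\<mu> \<theta>)"
    by (auto simp: Theta_minus_def comparable_orders_def landau_o.small_imp_big bigtheta_def)
  then obtain C where C: "0 < C" "\<forall>\<^sub>F n in sequentially. norm (\<psi> \<theta> n) \<le> C * norm (\<mu> \<theta> n)"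
    by (auto elim: landau_o.bigE)
  have pos: "0 < \<psi> \<theta> n" "0 < \<mu> \<theta> n" for n
    using \<theta> \<psi> \<mu> by (auto simp: Theta_minus_def normalization_family_def)
  have "\<forall>\<^sub>F n in sequentially. ennreal (\<psi> \<theta> n / \<mu> \<theta> n) \<le> ennreal C"
    using C(2)
  proof eventually_elim
    case (elim n)
    then show ?case using pos[of n] by (intro ennreal_leI) (simp add: divide_le_eq)
  qed
  then have "limsup (\<lambda>n. ennreal (\<psi> \<theta> n / \<mu> \<theta> n)) \<le> ennreal C" by (rule Limsup_bounded)
  then show False using \<theta> by (simp add: Theta_minus_def top_unique)
qed

text \<open>Smaller order in one of the two directions is membership in \<open>Theta_plus\<close>.
  Equal order bounds the quotient away from 0 and infinity, which is membership in
  \<open>Theta_zero\<close>.\<close>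

lemma comparable_orders_trichotomy:
  assumes \<phi>: "\<And>n. 0 < \<phi> \<theta> n" "\<And>n. 0 < \<phi> \<theta>' n" and \<theta>: "\<theta> \<in> \<Theta>\<^sub>r" "\<theta>' \<in> \<Theta>\<^sub>r"
    and cmp: "comparable_orders (\<phi> \<theta>) (\<phi> \<theta>')"
  shows "\<theta>' \<in> Theta_plus \<Theta>\<^sub>r \<phi> \<theta> \<or> \<theta> \<in> Theta_plus \<Theta>\<^sub>r \<phi> \<theta>' \<or> \<theta>' \<in> Theta_zero \<Theta>\<^sub>r \<phi> \<theta>"
proof -
  have plus: "\<theta>2 \<in> Theta_plus \<Theta>\<^sub>r \<phi> \<theta>1" if "\<phi> \<theta>2 \<in> o(\<phi> \<theta>1)" "\<theta>2 \<in> \<Theta>\<^sub>r" for \<theta>1 \<theta>2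
  proof -
    have "(\<lambda>n. ennreal (\<phi> \<theta>2 n / \<phi> \<theta>1 n)) \<longlonglongrightarrow> ennreal 0"
      by (intro tendsto_ennrealI smalloD_tendsto that)
    then have "limsup (\<lambda>n. ennreal (\<phi> \<theta>2 n / \<phi> \<theta>1 n)) = 0" by (simp add: lim_imp_Limsup)
    then show ?thesis using that by (simp add: Theta_plus_def)
  qed
  have zero: "\<theta>' \<in> Theta_zero \<Theta>\<^sub>r \<phi> \<theta>" if bt: "\<phi> \<theta> \<in> \<Theta>(\<phi> \<theta>')"
  proof -
    obtain C where C: "0 < C" "\<forall>\<^sub>F n in sequentially. norm (\<phi> \<theta> n) \<le> C * norm (\<phi> \<theta>' n)"
      by (rule landau_o.bigE[OF bigthetaD1[OF bt]]) blast
    obtain D where D: "0 < D" "\<forall>\<^sub>F n in sequentially. norm (\<phi> \<theta> n) \<ge> D * norm (\<phi> \<theta>' n)"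
      by (rule landau_omega.bigE[OF bigthetaD2[OF bt]]) blast
    have "\<forall>\<^sub>F n in sequentially. ennreal (1 / C) \<le> ennreal (\<phi> \<theta>' n / \<phi> \<theta> n)"
      using C(2)
    proof eventually_elim
      case (elim n)
      then show ?case using C(1) \<phi>[of n] by (intro ennreal_leI) (simp add: field_simps)
    qed
    then have "ennreal (1 / C) \<le> liminf (\<lambda>n. ennreal (\<phi> \<theta>' n / \<phi> \<theta> n))" by (rule Liminf_bounded)
    with C(1) have lo: "0 < liminf (\<lambda>n. ennreal (\<phi> \<theta>' n / \<phi> \<theta> n))"
      by (auto intro: less_le_trans[rotated])
    have "\<forall>\<^sub>F n in sequentially. ennreal (\<phi> \<theta>' n / \<phi> \<theta> n) \<le> ennreal (1 / D)"
      using D(2)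
    proof eventually_elim
      case (elim n)
      then show ?case using D(1) \<phi>[of n] by (intro ennreal_leI) (simp add: field_simps)
    qed
    then have "limsup (\<lambda>n. ennreal (\<phi> \<theta>' n / \<phi> \<theta> n)) \<le> ennreal (1 / D)" by (rule Limsup_bounded)
    then have "limsup (\<lambda>n. ennreal (\<phi> \<theta>' n / \<phi> \<theta> n)) < \<infinity>"
      by (rule le_less_trans) simp
    then show ?thesis using \<theta>(2) lo by (simp add: Theta_zero_def)
  qed
  show ?thesis using cmp plus zero \<theta> unfolding comparable_orders_def by blast
qed

section \<open>Optimality of the admissible normalization family\<close>

theorem theorem3:
  fixes \<nu> :: "'a measure"
    and \<Phi> :: "('a \<Rightarrow> real) \<Rightarrow> ereal"
    and \<Theta>\<^sub>r :: "(real ^ 'l) set" and \<Theta>\<^sub>c :: "'c set"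
    and F :: "real ^ 'l \<Rightarrow> 'c \<Rightarrow> ('a \<Rightarrow> real) set"
    and \<phi> \<psi> :: "real ^ 'l \<Rightarrow> nat \<Rightarrow> real"
    and p :: "nat \<Rightarrow> ennreal"
    and c :: "real ^ 'l \<Rightarrow> real ^ 'l \<Rightarrow> real"
  assumes params: "\<Theta>\<^sub>r \<in> ball_sets" "\<Theta>\<^sub>c \<noteq> {}"
    and classes: "\<And>\<theta> \<eta>. \<theta> \<in> \<Theta>\<^sub>r \<Longrightarrow> \<eta> \<in> \<Theta>\<^sub>c \<Longrightarrow> F \<theta> \<eta> \<subseteq> admissible_densities \<nu> \<Phi>"
    and rates: "\<And>\<theta> \<eta>. \<theta> \<in> \<Theta>\<^sub>r \<Longrightarrow> \<eta> \<in> \<Theta>\<^sub>c \<Longrightarrow> minimax_rate \<nu> \<Phi> (F \<theta> \<eta>) (\<phi> \<theta>)"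
    and optimal: "\<And>\<theta> \<eta>. \<theta> \<in> \<Theta>\<^sub>r \<Longrightarrow> \<eta> \<in> \<Theta>\<^sub>c \<Longrightarrow> \<exists>T. rate_optimal \<nu> \<Phi> (F \<theta> \<eta>) (\<phi> \<theta>) T"
    and comparable: "\<And>\<theta> \<theta>'. \<theta> \<in> \<Theta>\<^sub>r \<Longrightarrow> \<theta>' \<in> \<Theta>\<^sub>r \<Longrightarrow> comparable_orders (\<phi> \<theta>) (\<phi> \<theta>')"
    and normalization: "normalization_family \<Theta>\<^sub>r \<psi>"
    and p_def: "p = (\<lambda>n. SUP \<theta>\<in>\<Theta>\<^sub>r. ennreal (\<psi> \<theta> n / \<phi> \<theta> n))"
    and A1: "\<And>\<theta>. \<theta> \<in> \<Theta>\<^sub>r \<Longrightarrow>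
      \<exists>B\<in>ball_sets. \<exists>T\<in>hypermanifolds \<Theta>\<^sub>r. B \<subseteq> Theta_plus \<Theta>\<^sub>r \<phi> \<theta> \<and> Theta_zero \<Theta>\<^sub>r \<phi> \<theta> \<subseteq> T"
    and A2: "\<And>\<theta> \<theta>'. \<theta> \<in> \<Theta>\<^sub>r \<Longrightarrow> \<theta>' \<in> Theta_plus \<Theta>\<^sub>r \<phi> \<theta> \<Longrightarrow>
      0 < c \<theta> \<theta>' \<and> c \<theta> \<theta>' < 1 \<and> filterlim (alpha \<phi> c \<theta> \<theta>') at_top sequentially"
    and A3: "\<And>\<theta> \<theta>'. \<theta> \<in> \<Theta>\<^sub>r \<Longrightarrow> \<theta>' \<in> Theta_plus \<Theta>\<^sub>r \<phi> \<theta> \<Longrightarrow>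
      limsup (\<lambda>n. (p n)\<^sup>2 * ennreal ((\<phi> \<theta>' n) powr (1 - c \<theta> \<theta>'))) = 0"
    and lower: "\<And>\<theta> \<theta>' \<eta> \<eta>'. \<theta> \<in> \<Theta>\<^sub>r \<Longrightarrow> \<theta>' \<in> Theta_plus \<Theta>\<^sub>r \<phi> \<theta> \<Longrightarrow> \<eta> \<in> \<Theta>\<^sub>c \<Longrightarrow> \<eta>' \<in> \<Theta>\<^sub>c \<Longrightarrow>
      \<exists>f0 M \<Lambda> Y P.
        lower_bound_conditions \<nu> \<Phi> (F \<theta>' \<eta>') (F \<theta> \<eta>) (\<phi> \<theta>) (\<psi> \<theta>) f0 M \<Lambda> Y P \<and>
        (\<forall>i\<in>{1, 2}.
          (\<lambda>n. ennreal (1 / (alpha \<phi> c \<theta> \<theta>' n)\<^sup>2) *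
               exp_moment_product \<nu> i n (f0 n) (M n) (\<Lambda> n) (P n)) \<longlonglongrightarrow> 0)"
    and admissible: "\<psi> \<in> admissible_families \<nu> \<Phi> \<Theta>\<^sub>r \<Theta>\<^sub>c F"
  shows "adaptive_rate \<nu> \<Phi> \<Theta>\<^sub>r \<Theta>\<^sub>c F \<psi> \<and> price_to_pay \<nu> \<Phi> \<Theta>\<^sub>r \<Theta>\<^sub>c F \<phi> \<psi> p"
proof -
  have \<psi>pos: "0 < \<psi> \<theta> n" and \<phi>pos: "0 < \<phi> \<theta> n" if "\<theta> \<in> \<Theta>\<^sub>r" for \<theta> n
    using normalization rates that params(2) by (auto simp: normalization_family_def minimax_rate_def)
  \<comment> \<open>The product is split into three factors: the loss at \<open>\<theta>'\<close>
    damped by a power of \<open>\<phi> \<theta>'\<close>, bounded through \<open>A3\<close>; the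
    quotient of \<open>\<phi> \<theta>\<close> by \<open>\<mu> \<theta>\<close>, bounded by
    admissibility; and the quotient that the lower bound sends to 0.\<close>
  have key: "(\<lambda>n. \<psi> \<theta>' n / \<mu> \<theta>' n * (\<psi> \<theta> n / \<mu> \<theta> n)) \<longlonglongrightarrow> 0"
    if \<mu>: "\<mu> \<in> admissible_families \<nu> \<Phi> \<Theta>\<^sub>r \<Theta>\<^sub>c F" and \<theta>: "\<theta> \<in> Theta_minus \<Theta>\<^sub>r \<psi> \<mu>"
      and \<theta>': "\<theta>' \<in> Theta_plus \<Theta>\<^sub>r \<phi> \<theta>" for \<mu> \<theta> \<theta>'
  proof -
    obtain \<eta> where \<eta>: "\<eta> \<in> \<Theta>\<^sub>c" using params(2) by auto
    have in_r: "\<theta> \<in> \<Theta>\<^sub>r" "\<theta>' \<in> \<Theta>\<^sub>r" using \<theta> \<theta>' by (auto simp: Theta_minus_def Theta_plus_def)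
    obtain T where nf: "normalization_family \<Theta>\<^sub>r \<mu>" and T: "\<And>n. T n \<in> estimators \<nu> n"
      and fin: "\<And>\<theta>. \<theta> \<in> \<Theta>\<^sub>r \<Longrightarrow> limsup (\<lambda>n. risk \<nu> \<Phi> n (T n) (F \<theta> \<eta>) / ennreal (\<mu> \<theta> n)) < \<infinity>"
      using \<mu> \<eta> unfolding admissible_families_def by blast
    have \<mu>pos: "0 < \<mu> \<theta> n" "0 < \<mu> \<theta>' n" for n using nf in_r by (auto simp: normalization_family_def)
    have \<alpha>pos: "0 < alpha \<phi> c \<theta> \<theta>' n" for n
      using \<phi>pos[OF in_r(1)] \<phi>pos[OF in_r(2), of n] by (simp add: alpha_def)
    obtain f0 M \<Lambda> Y P where
      lb: "lower_bound_conditions \<nu> \<Phi> (F \<theta>' \<eta>) (F \<theta> \<eta>) (\<phi> \<theta>) (\<psi> \<theta>) f0 M \<Lambda> Y P" and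
      mom: "\<forall>i\<in>{1, 2}. (\<lambda>n. ennreal (1 / (alpha \<phi> c \<theta> \<theta>' n)\<^sup>2) *
               exp_moment_product \<nu> i n (f0 n) (M n) (\<Lambda> n) (P n)) \<longlonglongrightarrow> 0"
      using lower[OF in_r(1) \<theta>' \<eta> \<eta>] by blast
    \<comment> \<open>Most perturbations lie in the class of \<theta>, where the risk is of smaller
      order than \<open>\<psi> \<theta>\<close>; the base densities lie in the class of
      \<open>\<theta>'\<close>, where the rate is thereby forced up.\<close>
    have lim: "(\<lambda>n. \<psi> \<theta> n / (\<mu> \<theta>' n * alpha \<phi> c \<theta> \<theta>' n)) \<longlonglongrightarrow> 0"
      using lower_bound_ratio[OF lb classes[OF in_r(1) \<eta>] T \<psi>pos[OF in_r(1)] \<mu>pos \<alpha>pos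
        mom[rule_format, of 1] fin[OF in_r(1)] fin[OF in_r(2)] Theta_minus_smallo[OF normalization nf \<theta>]]
      by simp
    obtain K where K: "0 < K" "\<forall>\<^sub>F n in sequentially. \<phi> \<theta> n \<le> K * \<mu> \<theta> n"
      using minimax_rate_le_admissible[OF rates[OF in_r(1) \<eta>] T \<mu>pos(1) fin[OF in_r(1)]] .
    \<comment> \<open>This gives \<open>1 \<le> p n\<close> eventually, so \<open>p n\<close> is at
      most its square, the quantity controlled by \<open>A3\<close>.\<close>
    have "\<forall>\<^sub>F n in sequentially. 1 \<le> \<psi> \<theta> n / \<phi> \<theta> n"
      using lb by (simp add: lower_bound_conditions_def filterlim_at_top)
    moreover have "\<forall>\<^sub>F n in sequentially. (p n)\<^sup>2 * ennreal (\<phi> \<theta>' n powr (1 - c \<theta> \<theta>')) < 1"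
      using A3[OF in_r(1) \<theta>'] by (intro Limsup_lessD) simp
    ultimately have "\<forall>\<^sub>F n in sequentially. norm (\<psi> \<theta>' n / \<mu> \<theta>' n * (\<psi> \<theta> n / \<mu> \<theta> n))
        \<le> K * (\<psi> \<theta> n / (\<mu> \<theta>' n * alpha \<phi> c \<theta> \<theta>' n))"
      using K(2)
    proof eventually_elim
      case (elim n)
      note pos = \<psi>pos[OF in_r(1), of n] \<psi>pos[OF in_r(2), of n] \<phi>pos[OF in_r(1), of n]
        \<phi>pos[OF in_r(2), of n] \<mu>pos[of n] \<alpha>pos[of n]
      let ?w = "\<phi> \<theta>' n powr (1 - c \<theta> \<theta>')"
      have p_ge: "ennreal (\<psi> \<theta>'' n / \<phi> \<theta>'' n) \<le> p n" if "\<theta>'' \<in> \<Theta>\<^sub>r" for \<theta>''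
        unfolding p_def using that by (rule SUP_upper)
      have "1 \<le> ennreal (\<psi> \<theta> n / \<phi> \<theta> n)" using elim(1) by simp
      then have "1 \<le> p n" using p_ge[OF in_r(1)] by (rule order_trans)
      then have "p n * 1 \<le> (p n)\<^sup>2" unfolding power2_eq_square by (intro mult_left_mono) auto
      then have "ennreal (\<psi> \<theta>' n / \<phi> \<theta>' n) \<le> (p n)\<^sup>2" using p_ge[OF in_r(2)] by simp
      then have "ennreal (\<psi> \<theta>' n / \<phi> \<theta>' n) * ennreal ?w \<le> (p n)\<^sup>2 * ennreal ?w"
        by (intro mult_right_mono) auto
      also have "\<dots> \<le> 1" using elim(2) by simp
      finally have "\<psi> \<theta>' n / \<phi> \<theta>' n * ?w \<le> 1"
        using pos by (simp flip: ennreal_mult)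
      moreover have "\<phi> \<theta> n / \<mu> \<theta> n \<le> K" using elim(3) pos by (simp add: pos_divide_le_eq)
      ultimately have "(\<psi> \<theta>' n / \<phi> \<theta>' n * ?w) * (\<phi> \<theta> n / \<mu> \<theta> n) \<le> 1 * K"
        using pos by (intro mult_mono) auto
      then have "((\<psi> \<theta>' n / \<phi> \<theta>' n * ?w) * (\<phi> \<theta> n / \<mu> \<theta> n)) * (\<psi> \<theta> n / (\<mu> \<theta>' n * alpha \<phi> c \<theta> \<theta>' n))
          \<le> K * (\<psi> \<theta> n / (\<mu> \<theta>' n * alpha \<phi> c \<theta> \<theta>' n))"
        using pos by (intro mult_right_mono) auto
      \<comment> \<open>Dividing by \<open>alpha\<close> contributes
        \<open>\<phi> \<theta>' n\<close> to the power \<open>c \<theta> \<theta>'\<close>, which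
        together with \<open>?w\<close> cancels the denominator \<open>\<phi> \<theta>' n\<close>;
        the factors \<open>\<phi> \<theta> n\<close> cancel as well.\<close>
      also have "((\<psi> \<theta>' n / \<phi> \<theta>' n * ?w) * (\<phi> \<theta> n / \<mu> \<theta> n)) * (\<psi> \<theta> n / (\<mu> \<theta>' n * alpha \<phi> c \<theta> \<theta>' n))
          = \<psi> \<theta>' n / \<mu> \<theta>' n * (\<psi> \<theta> n / \<mu> \<theta> n)"
        using pos by (simp add: alpha_def powr_diff field_simps)
      finally show ?case using pos by simp
    qed
    moreover have "(\<lambda>n. K * (\<psi> \<theta> n / (\<mu> \<theta>' n * alpha \<phi> c \<theta> \<theta>' n))) \<longlonglongrightarrow> 0"
      using tendsto_mult_left[OF lim, of K] by simp
    ultimately show ?thesis by (rule Lim_null_comparison)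
  qed
  \<comment> \<open>On \<open>Theta_minus\<close> both quotients of \<psi> by \<mu> are eventually
    at least 1, so their product cannot tend to 0.\<close>
  have not_plus: "\<theta>' \<notin> Theta_plus \<Theta>\<^sub>r \<phi> \<theta>"
    if \<mu>: "\<mu> \<in> admissible_families \<nu> \<Phi> \<Theta>\<^sub>r \<Theta>\<^sub>c F"
      and \<theta>: "\<theta> \<in> Theta_minus \<Theta>\<^sub>r \<psi> \<mu>" "\<theta>' \<in> Theta_minus \<Theta>\<^sub>r \<psi> \<mu>" for \<mu> \<theta> \<theta>'
  proof
    assume "\<theta>' \<in> Theta_plus \<Theta>\<^sub>r \<phi> \<theta>"
    from order_tendstoD(2)[OF key[OF \<mu> \<theta>(1) this], of 1]
    have lt1: "\<forall>\<^sub>F n in sequentially. \<psi> \<theta>' n / \<mu> \<theta>' n * (\<psi> \<theta> n / \<mu> \<theta> n) < 1" by simp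
    have nf: "normalization_family \<Theta>\<^sub>r \<mu>" using \<mu> by (simp add: admissible_families_def)
    have ge1: "\<forall>\<^sub>F n in sequentially. 1 \<le> \<psi> \<theta>'' n / \<mu> \<theta>'' n" if "\<theta>'' \<in> Theta_minus \<Theta>\<^sub>r \<psi> \<mu>" for \<theta>''
    proof -
      have r: "\<theta>'' \<in> \<Theta>\<^sub>r" using that by (simp add: Theta_minus_def)
      have "\<forall>\<^sub>F n in sequentially. norm (\<mu> \<theta>'' n) \<le> 1 * norm (\<psi> \<theta>'' n)"
        using landau_o.smallD[OF Theta_minus_smallo[OF normalization nf that], of 1] by simp
      then show ?thesis
      proof eventually_elim
        case (elim n)
        then show ?case using r nf \<psi>pos[OF r, of n] by (auto simp: normalization_family_def pos_le_divide_eq)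
      qed
    qed
    have "\<forall>\<^sub>F n in sequentially. False"
      using lt1 ge1[OF \<theta>(1)] ge1[OF \<theta>(2)]
    proof eventually_elim
      case (elim n)
      then show ?case using mult_mono[OF elim(3,2)] by simp
    qed
    then show False by simp
  qed
  have "adaptive_rate \<nu> \<Phi> \<Theta>\<^sub>r \<Theta>\<^sub>c F \<psi>"
    unfolding adaptive_rate_def
  proof (intro conjI ballI admissible)
    fix \<mu> assume \<mu>: "\<mu> \<in> admissible_families \<nu> \<Phi> \<Theta>\<^sub>r \<Theta>\<^sub>c F"
    \<comment> \<open>The reference point is any element of \<open>Theta_minus\<close>; if there is
      none, the centre of a ball in the parameter set still allows \<open>A1\<close> to supply a
      manifold.\<close>
    obtain \<theta>0 where \<theta>0: "\<theta>0 \<in> \<Theta>\<^sub>r" "Theta_minus \<Theta>\<^sub>r \<psi> \<mu> \<noteq> {} \<longrightarrow> \<theta>0 \<in> Theta_minus \<Theta>\<^sub>r \<psi> \<mu>"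
    proof (cases "Theta_minus \<Theta>\<^sub>r \<psi> \<mu> = {}")
      case True
      obtain a r where "0 < r" "ball a r \<subseteq> \<Theta>\<^sub>r" using params(1) unfolding ball_sets_def by blast
      then have "a \<in> \<Theta>\<^sub>r" using centre_in_ball by blast
      then show thesis using that True by blast
    next
      case False
      then show thesis using that by (auto simp: Theta_minus_def)
    qed
    obtain T where T: "T \<in> hypermanifolds \<Theta>\<^sub>r" "Theta_zero \<Theta>\<^sub>r \<phi> \<theta>0 \<subseteq> T"
      using A1[OF \<theta>0(1)] by blast
    have "Theta_minus \<Theta>\<^sub>r \<psi> \<mu> \<subseteq> Theta_zero \<Theta>\<^sub>r \<phi> \<theta>0"
    proof
      fix \<theta> assume \<theta>: "\<theta> \<in> Theta_minus \<Theta>\<^sub>r \<psi> \<mu>"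
      then have \<theta>r: "\<theta> \<in> \<Theta>\<^sub>r" by (simp add: Theta_minus_def)
      have m0: "\<theta>0 \<in> Theta_minus \<Theta>\<^sub>r \<psi> \<mu>" using \<theta>0(2) \<theta> by blast
      show "\<theta> \<in> Theta_zero \<Theta>\<^sub>r \<phi> \<theta>0"
        \<comment> \<open>Neither point can be in \<open>Theta_plus\<close> of the other, so only
          equal order remains.\<close>
        using comparable_orders_trichotomy[where \<phi> = \<phi>, OF \<phi>pos[OF \<theta>0(1)] \<phi>pos[OF \<theta>r] \<theta>0(1) \<theta>r comparable[OF \<theta>0(1) \<theta>r]]
          not_plus[OF \<mu> m0 \<theta>] not_plus[OF \<mu> \<theta> m0] by blast
    qed
    then show "\<exists>T\<in>hypermanifolds \<Theta>\<^sub>r. Theta_minus \<Theta>\<^sub>r \<psi> \<mu> \<subseteq> T" using T by blast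
  next
    fix \<mu> \<theta> assume \<mu>: "\<mu> \<in> admissible_families \<nu> \<Phi> \<Theta>\<^sub>r \<Theta>\<^sub>c F" and \<theta>: "\<theta> \<in> Theta_minus \<Theta>\<^sub>r \<psi> \<mu>"
    then have \<theta>r: "\<theta> \<in> \<Theta>\<^sub>r" by (simp add: Theta_minus_def)
    have "limsup (\<lambda>n. ennreal (\<psi> \<theta>' n / \<mu> \<theta>' n * (\<psi> \<theta> n / \<mu> \<theta> n))) = 0"
      if "\<theta>' \<in> Theta_plus \<Theta>\<^sub>r \<phi> \<theta>" for \<theta>'
      using lim_imp_Limsup[OF sequentially_bot tendsto_ennrealI[OF key[OF \<mu> \<theta> that]]] by simp
    moreover have "Theta_plus \<Theta>\<^sub>r \<phi> \<theta> \<subseteq> \<Theta>\<^sub>r" by (auto simp: Theta_plus_def)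
    moreover have "\<exists>B\<in>ball_sets. B \<subseteq> Theta_plus \<Theta>\<^sub>r \<phi> \<theta>" using A1[OF \<theta>r] by blast
    \<comment> \<open>The witness is \<open>Theta_plus\<close> of \<theta>, which contains a ball by
      \<open>A1\<close>.\<close>
    ultimately show "\<exists>A\<subseteq>\<Theta>\<^sub>r. (\<exists>B\<in>ball_sets. B \<subseteq> A) \<and>
        (\<forall>\<theta>'\<in>A. limsup (\<lambda>n. ennreal (\<psi> \<theta>' n / \<mu> \<theta>' n * (\<psi> \<theta> n / \<mu> \<theta> n))) = 0)"
      by (intro exI[of _ "Theta_plus \<Theta>\<^sub>r \<phi> \<theta>"]) blast
  qed
  then show ?thesis using rates by (simp add: price_to_pay_def p_def)
qed

end
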